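(* For each positive integer $n$, let $(V_n,B_n)$ denote the perfect binary tree of depth $n$. For $p\in(0,1)$, consider discrete-time dynamical percolation on $B_n$ with parameter $p$, and let $f_n:\{-1,1\}^{B_n}\to\mathbb{R}$ be the size of the cluster containing the root. Then the following hold. (i) Let $(s_n)$ be a sequence of positive integers. If $p\in(0,1)$ and $p\neq 1/2$, then $$\lim_{n\to\infty}\rho_{p,f_n}(s_n)=\begin{cases}1, & \text{if } s_n=o(|B_n|),\\ 0, & \text{if } |B_n|=o(s_n).\end{cases}$$ (ii) Let $(s_n)$ be a sequence of positive integers. Then $$\lim_{n\to\infty}\rho_{1/2,f_n}(s_n)=\begin{cases}1, & \text{if } s_n=o(|B_n|/n),\\ 0, & \text{if } |B_n|/n=o(s_n).\end{cases}$$ (iii) As $n\to\infty$ (with $p$ fixed), $$\frac{\tau_{p,f_n}}{|B_n|}\sim\begin{cases}\dfrac{1-2p}{2p(1-p)}\log\left(\dfrac{1-2p^2}{1-2p}\right), & p\in(0,1/2),\\[3mm] 6\,\dfrac{\log n}{n}, & p=1/2,\\[3mm] \dfrac{2p-1}{1-p}\log\left(\dfrac{p}{2p-1}\right), & p\in(1/2,1).\end{cases}$$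
   Context: **Discrete-time dynamical percolation.** Let $S=\{-1,1\}$, let $B$ be a finite set (of "bits") and $p\in(0,1)$. Let $\pi_p$ be the probability measure on $S$ with $\pi_p(+1)=p$, $\pi_p(-1)=1-p$, and let $\pi_{p,B}(x)=\prod_{i\in B}\pi_p(x_i)$ for $x\in S^B$. A bit $i\in B$ is open in $x$ if $x_i=+1$ and closed if $x_i=-1$. Let $P_{p,B}$ be the stochastic matrix on $S^B$ with entries $$P_{p,B}(x,y)=\frac{1}{|B|}\sum_{i\in B}\pi_p(y_i)\prod_{j\in B\setminus\{i\}}\mathbf{1}(y_j=x_j).$$ Discrete-time dynamical percolation on $B$ with parameter $p$ is a stationary Markov chain $(Z^{p,B}_s)_{s\in\{0,1,2,\dots\}}$ with transition matrix $P_{p,B}$, where each $Z^{p,B}_s$ has distribution $\pi_{p,B}$. **Autocorrelations.** For a non-constant $f:S^B\to\mathbb{R}$, define, for integers $s\ge 0$, $$\rho_{p,f}(s)=\frac{\operatorname{cov}(f(Z^{p,B}_0),f(Z^{p,B}_s))}{\operatorname{var}(f(Z^{p,B}_0))},\qquad \tau_{p,f}=\frac12\sum_{s\in\mathbb{Z}}\rho_{p,f}(|s|).$$ **Trees and clusters.** A binary tree is a rooted tree in which each vertex has at most 2 children; it is perfect if each non-leaf vertex has exactly two children and all leaves have the same depth. Here $V_n$ is the vertex set and $B_n$ the edge set of the perfect binary tree whose leaves have depth $n$. For $x\in S^{B_n}$, clusters are the connected components of the spanning subgraph of $(V_n,B_n)$ formed by the open edges of $x$; the size of a cluster is its number of vertices.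 **Asymptotics.** $a_n\sim b_n$ means $a_n/b_n\to1$ as $n\to\infty$, and $a_n=o(b_n)$ means $a_n/b_n\to 0$. $\log$ is the natural logarithm. *)

theory Defs
  imports "HOL-Probability.Probability" "HOL-Library.Landau_Symbols"
begin

text \<open>The state space \<open>E\<close> is understood to be finite. The Markov property is required for every history \<open>h\<close> of positive probability (histories of
  probability zero impose nothing, conditional probabilities being undefined there).
  That every \<open>Z s\<close> has law \<open>\<mu>\<close> makes the chain stationary.\<close>

definition stationary_markov_chain ::
  "'s set \<Rightarrow> ('s \<Rightarrow> real) \<Rightarrow> ('s \<Rightarrow> 's \<Rightarrow> real) \<Rightarrow> 'w measure \<Rightarrow> (nat \<Rightarrow> 'w \<Rightarrow> 's) \<Rightarrow> bool"
where
  "stationary_markov_chain E \<mu> P M Z \<longleftrightarrow>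
     prob_space M \<and>
     (\<forall>s. Z s \<in> measurable M (count_space E)) \<and>
     (\<forall>s. \<forall>x\<in>E. \<P>(\<omega> in M. Z s \<omega> = x) = \<mu> x) \<and>
     (\<forall>s. \<forall>h. \<forall>y\<in>E. \<P>(\<omega> in M. \<forall>r\<le>s. Z r \<omega> = h r) > 0 \<longrightarrow>
        \<P>(\<omega> in M. Z (Suc s) \<omega> = y \<bar> \<forall>r\<le>s. Z r \<omega> = h r) = P (h s) y)"

definition cov :: "'w measure \<Rightarrow> ('w \<Rightarrow> real) \<Rightarrow> ('w \<Rightarrow> real) \<Rightarrow> real" where
  "cov M X Y = (\<integral>\<omega>. (X \<omega> - integral\<^sup>L M X) * (Y \<omega> - integral\<^sup>L M Y) \<partial>M)"

definition autocorr ::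
  "'w measure \<Rightarrow> (nat \<Rightarrow> 'w \<Rightarrow> 's) \<Rightarrow> ('s \<Rightarrow> real) \<Rightarrow> nat \<Rightarrow> real"
where
  "autocorr M Z f s =
     cov M (\<lambda>\<omega>. f (Z 0 \<omega>)) (\<lambda>\<omega>. f (Z s \<omega>)) / prob_space.variance M (\<lambda>\<omega>. f (Z 0 \<omega>))"

text \<open>The two-sided sum is unordered; \<open>infsum\<close> would return \<open>0\<close> for a family that is not summable, which
  cannot occur for the finite, irreducible, aperiodic chains considered here.\<close>

definition autocorr_time :: "'w measure \<Rightarrow> (nat \<Rightarrow> 'w \<Rightarrow> 's) \<Rightarrow> ('s \<Rightarrow> real) \<Rightarrow> real" where
  "autocorr_time M Z f = 1/2 * (\<Sum>\<^sub>\<infinity>s\<in>(UNIV :: int set). autocorr M Z f (nat \<bar>s\<bar>))"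

text \<open>A configuration in \<open>{-1,1}\<^sup>B\<close> is an extensional function on \<open>B\<close>.\<close>

definition configs :: "'b set \<Rightarrow> ('b \<Rightarrow> int) set" where
  "configs B = B \<rightarrow>\<^sub>E {-1, 1}"

definition bit_weight :: "real \<Rightarrow> int \<Rightarrow> real" where
  "bit_weight p c = (if c = 1 then p else if c = -1 then 1 - p else 0)"

definition perc_weight :: "real \<Rightarrow> 'b set \<Rightarrow> ('b \<Rightarrow> int) \<Rightarrow> real" where
  "perc_weight p B x = (\<Prod>i\<in>B. bit_weight p (x i))"

definition perc_kernel :: "real \<Rightarrow> 'b set \<Rightarrow> ('b \<Rightarrow> int) \<Rightarrow> ('b \<Rightarrow> int) \<Rightarrow> real" where
  "perc_kernel p B x y =
     1 / real (card B) *
       (\<Sum>i\<in>B. bit_weight p (y i) * (\<Prod>j\<in>B - {i}. of_bool (y j = x j)))"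

definition dynamical_percolation ::
  "real \<Rightarrow> 'b set \<Rightarrow> 'w measure \<Rightarrow> (nat \<Rightarrow> 'w \<Rightarrow> 'b \<Rightarrow> int) \<Rightarrow> bool"
where
  "dynamical_percolation p B M Z \<longleftrightarrow>
     stationary_markov_chain (configs B) (perc_weight p B) (perc_kernel p B) M Z"

text \<open>A vertex is the list of left/right turns on the path from the root \<open>[]\<close> to it, so its depth is
  its length and its children are \<open>v @ [False]\<close> and \<open>v @ [True]\<close>. Edges are unordered pairs.\<close>

definition tree_verts :: "nat \<Rightarrow> bool list set" where
  "tree_verts n = {v. length v \<le> n}"

definition tree_edges :: "nat \<Rightarrow> bool list set set" where
  "tree_edges n = {{v, v @ [b]} | v b. v \<in> tree_verts n \<and> v @ [b] \<in> tree_verts n}"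

definition open_adj :: "'v set set \<Rightarrow> ('v set \<Rightarrow> int) \<Rightarrow> ('v \<times> 'v) set" where
  "open_adj B x = {(u, v). {u, v} \<in> B \<and> x {u, v} = 1}"

definition clusters :: "'v set \<Rightarrow> 'v set set \<Rightarrow> ('v set \<Rightarrow> int) \<Rightarrow> 'v set set" where
  "clusters V B x = V // ((open_adj B x)\<^sup>* \<inter> V \<times> V)"

definition cluster_size :: "'v set \<Rightarrow> 'v set set \<Rightarrow> 'v \<Rightarrow> ('v set \<Rightarrow> int) \<Rightarrow> real" where
  "cluster_size V B v x = real (card (THE C. C \<in> clusters V B x \<and> v \<in> C))"

definition root_cluster_size :: "nat \<Rightarrow> (bool list set \<Rightarrow> int) \<Rightarrow> real" where
  "root_cluster_size n = cluster_size (tree_verts n) (tree_edges n) []"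

end

theory Submission
  imports Defs "HOL-Library.Sublist" "HOL-Real_Asymp.Real_Asymp"
begin

text \<open>
  The root cluster size is a sum of path indicators: \<open>v\<close> belongs to the cluster of the root iff every edge
  on the path from the root to \<open>v\<close> is open (\<open>root_cluster_size_eq\<close>). One step of the dynamics resamples a
  uniformly chosen edge, so the product \<open>\<Prod>e\<in>A. (of_bool (x e = 1) - p)\<close> is an eigenfunction with
  eigenvalue \<open>1 - |A|/m\<close>, where \<open>m\<close> is the number of edges. Expanding the path indicators in these
  orthogonal functions, the vertices \<open>u\<close> and \<open>v\<close> interact only through the \<open>h\<close> edges that their paths
  share, and the covariance of the cluster sizes at times \<open>0\<close> and \<open>s\<close> becomes a sum over pairs \<open>(u, v)\<close> of
  \<open>p ^ (|u| + |v| - h)\<close> times the expectation of \<open>(1 - K/m) ^ s\<close> on \<open>K \<ge> 1\<close>, for a binomial variable \<open>K\<close>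
  with parameters \<open>h\<close> and \<open>1 - p\<close> (\<open>root_cluster_covariance\<close>). In other words, the autocorrelation at
  time \<open>s\<close> is the mean of \<open>(1 - K/m) ^ s\<close>, where the length \<open>H\<close> of the common path is drawn with weight
  \<open>(2p)^h * meet_sum p (n - h)\<close>, then \<open>K\<close> is binomial given \<open>H\<close>, and everything is conditioned on
  \<open>K \<ge> 1\<close>. Summing geometric series over \<open>s\<close>, the autocorrelation time divided by \<open>m\<close> is the mean of
  \<open>1/K\<close> minus \<open>1/(2m)\<close> (\<open>root_cluster_autocorr_time\<close>).

  It remains to know the law of \<open>K\<close>. For \<open>p \<noteq> 1/2\<close> the weights of \<open>H\<close>, suitably rescaled, converge
  dominatedly to a geometric sequence \<open>r ^ h\<close>, with \<open>r = 2p\<close> below and \<open>r = 1/(2p)\<close> above criticality. Hence \<open>K\<close>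
  stays bounded in mean, \<open>m\<close> is the only time scale, and the mean of \<open>1/K\<close> converges to a quotient of two explicit
  generating functions (\<open>off_critical_mean_reciprocal\<close>). Both regimes are thereby treated at once.

  For \<open>p = 1/2\<close> the weight of \<open>H = h\<close> is about \<open>(n - h)^2 / 2\<close>, so \<open>H\<close> and \<open>K\<close> are of order \<open>n\<close> and the time
  scale is \<open>m/n\<close>. The total weight is about \<open>n ^ 3 / 6\<close>, whereas \<open>1/K\<close> has conditional expectation about
  \<open>2/h\<close>; the weighted sum of the latter is about \<open>n^2 * ln n\<close>, a harmonic sum. The quotient is
  \<open>6 * ln n / n\<close> (\<open>critical_mean_reciprocal\<close>).

  The limits of the autocorrelations need only elementary bounds: \<open>1 - (1 - k/m)^s \<le> s * k / m\<close> for the limit \<open>1\<close>,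
  and \<open>(1 - k/m)^s \<le> (1 - 1/m)^(s * k)\<close> for the limit \<open>0\<close>. Both hold because \<open>k \<le> n \<le> m\<close> keeps the
  eigenvalues \<open>1 - k/m\<close> nonnegative (\<open>depth_le_card_tree_edges\<close>).
\<close>

section \<open>Stationary finite Markov chains\<close>

lemma finite_range_expectation:
  fixes g :: "'s \<Rightarrow> real"
  assumes "prob_space M" "finite E" "X \<in> measurable M (count_space E)"
  shows "integrable M (\<lambda>\<omega>. g (X \<omega>))"
    and "(\<integral>\<omega>. g (X \<omega>) \<partial>M) = (\<Sum>x\<in>E. g x * \<P>(\<omega> in M. X \<omega> = x))"
proof -
  interpret prob_space M by fact
  have XE: "X \<omega> \<in> E" if "\<omega> \<in> space M" for \<omega>
    using measurable_space[OF assms(3) that] by simp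
  have sets: "{\<omega> \<in> space M. X \<omega> = x} \<in> sets M" if "x \<in> E" for x
  proof -
    have "X -` {x} \<inter> space M \<in> sets M"
      using assms(3) that by (auto intro: measurable_sets)
    also have "X -` {x} \<inter> space M = {\<omega> \<in> space M. X \<omega> = x}" by auto
    finally show ?thesis .
  qed
  have eq: "g (X \<omega>) = (\<Sum>x\<in>E. g x * indicator {\<omega> \<in> space M. X \<omega> = x} \<omega>)" if "\<omega> \<in> space M" for \<omega>
  proof -
    have "(\<Sum>x\<in>E. g x * indicator {\<omega> \<in> space M. X \<omega> = x} \<omega>) = (\<Sum>x\<in>E. if x = X \<omega> then g x else 0)"
      using that by (intro sum.cong) (auto simp: indicator_def)
    with XE[OF that] assms(2) show ?thesis by simp
  qed
  have int: "integrable M (\<lambda>\<omega>. g x * indicator {\<omega> \<in> space M. X \<omega> = x} \<omega> :: real)" if "x \<in> E" for x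
    using sets[OF that] by (intro integrable_mult_right) (simp add: emeasure_eq_measure)
  have "integrable M (\<lambda>\<omega>. \<Sum>x\<in>E. g x * indicator {\<omega> \<in> space M. X \<omega> = x} \<omega> :: real)"
    by (intro Bochner_Integration.integrable_sum int)
  then show "integrable M (\<lambda>\<omega>. g (X \<omega>))"
    by (subst Bochner_Integration.integrable_cong[OF refl eq]) auto
  have "(\<integral>\<omega>. g (X \<omega>) \<partial>M) = (\<integral>\<omega>. (\<Sum>x\<in>E. g x * indicator {\<omega> \<in> space M. X \<omega> = x} \<omega>) \<partial>M)"
    by (intro Bochner_Integration.integral_cong eq refl)
  also have "\<dots> = (\<Sum>x\<in>E. \<integral>\<omega>. g x * indicator {\<omega> \<in> space M. X \<omega> = x} \<omega> \<partial>M)"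
    by (intro Bochner_Integration.integral_sum int)
  also have "\<dots> = (\<Sum>x\<in>E. g x * \<P>(\<omega> in M. X \<omega> = x))"
    using sets by (intro sum.cong) auto
  finally show "(\<integral>\<omega>. g (X \<omega>) \<partial>M) = (\<Sum>x\<in>E. g x * \<P>(\<omega> in M. X \<omega> = x))" .
qed

text \<open>The transition matrix acting on functions rather than on measures.\<close>

definition transition :: "'s set \<Rightarrow> ('s \<Rightarrow> 's \<Rightarrow> real) \<Rightarrow> ('s \<Rightarrow> real) \<Rightarrow> 's \<Rightarrow> real" where
  "transition E P g x = (\<Sum>y\<in>E. P x y * g y)"

text \<open>The Markov property conditions on whole histories. A history up to time \<open>s\<close> is treated as one random element with finitely many values, so that expectations become finite sums over histories.\<close>

lemma history_measurable:
  assumes "finite E" "\<And>s. Z s \<in> measurable M (count_space E)"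
  shows "(\<lambda>\<omega>. restrict (\<lambda>r. Z r \<omega>) {..s::nat}) \<in> measurable M (count_space ({..s} \<rightarrow>\<^sub>E E))"
proof (subst measurable_count_space_eq2)
  show "finite ({..s} \<rightarrow>\<^sub>E E)" using assms(1) by (simp add: finite_PiE)
  have sp: "Z r \<omega> \<in> E" if "\<omega> \<in> space M" for r \<omega>
    using measurable_space[OF assms(2) that] by simp
  show "(\<lambda>\<omega>. restrict (\<lambda>r. Z r \<omega>) {..s}) \<in> space M \<rightarrow> ({..s} \<rightarrow>\<^sub>E E) \<and>
    (\<forall>h\<in>{..s} \<rightarrow>\<^sub>E E. (\<lambda>\<omega>. restrict (\<lambda>r. Z r \<omega>) {..s}) -` {h} \<inter> space M \<in> sets M)"
  proof (intro conjI ballI)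
    fix h assume h: "h \<in> {..s} \<rightarrow>\<^sub>E E"
    have "(\<lambda>\<omega>. restrict (\<lambda>r. Z r \<omega>) {..s}) -` {h} \<inter> space M = (\<Inter>r\<in>{..s}. Z r -` {h r} \<inter> space M)"
      using h by (auto simp: fun_eq_iff PiE_iff extensional_def)
    also have "\<dots> \<in> sets M"
      using assms(2) h by (intro sets.finite_INT) (auto intro!: measurable_sets simp: PiE_iff)
    finally show "(\<lambda>\<omega>. restrict (\<lambda>r. Z r \<omega>) {..s}) -` {h} \<inter> space M \<in> sets M" .
  qed (use sp in auto)
qed

text \<open>Summing the Markov property over all histories and over the next state lets the last time step act on \<open>f\<close>. Histories of probability zero contribute nothing on either side.\<close>

lemma markov_one_step:
  fixes f g :: "'s \<Rightarrow> real"
  assumes "stationary_markov_chain E \<mu> P M Z" "finite E"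
  shows "(\<integral>\<omega>. g (Z 0 \<omega>) * f (Z (Suc s) \<omega>) \<partial>M) = (\<integral>\<omega>. g (Z 0 \<omega>) * transition E P f (Z s \<omega>) \<partial>M)"
proof -
  interpret prob_space M using assms by (simp add: stationary_markov_chain_def)
  have Z: "\<And>s. Z s \<in> measurable M (count_space E)"
    using assms by (simp add: stationary_markov_chain_def)
  define H where "H k \<omega> = restrict (\<lambda>r. Z r \<omega>) {..k}" for k \<omega>
  have Hm: "H k \<in> measurable M (count_space ({..k} \<rightarrow>\<^sub>E E))" for k
    unfolding H_def by (rule history_measurable[OF assms(2) Z])
  have fin: "finite ({..k::nat} \<rightarrow>\<^sub>E E)" for k using assms(2) by (simp add: finite_PiE)
  have HP: "H k \<omega> = h \<longleftrightarrow> (\<forall>r\<le>k. Z r \<omega> = h r)" if "h \<in> {..k} \<rightarrow>\<^sub>E E" for h k \<omega>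
    using that unfolding H_def by (auto simp: fun_eq_iff PiE_iff extensional_def)
  have step: "\<P>(\<omega> in M. Z (Suc s) \<omega> = y \<and> H s \<omega> = h) = P (h s) y * \<P>(\<omega> in M. H s \<omega> = h)"
    if h: "h \<in> {..s} \<rightarrow>\<^sub>E E" and y: "y \<in> E" for h y
  proof (cases "\<P>(\<omega> in M. H s \<omega> = h) > 0")
    case True
    then have "\<P>(\<omega> in M. Z (Suc s) \<omega> = y \<bar> H s \<omega> = h) = P (h s) y"
      using assms(1) y unfolding HP[OF h] stationary_markov_chain_def by blast
    with True show ?thesis by (simp add: cond_prob_def field_simps)
  next
    case False
    then have 0: "\<P>(\<omega> in M. H s \<omega> = h) = 0" using measure_nonneg[of M] by (meson antisym_conv2 not_less)
    have "{\<omega> \<in> space M. H s \<omega> = h} \<in> sets M"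
    proof -
      have "H s -` {h} \<inter> space M \<in> sets M" using Hm h by (auto intro: measurable_sets)
      also have "H s -` {h} \<inter> space M = {\<omega> \<in> space M. H s \<omega> = h}" by auto
      finally show ?thesis .
    qed
    then have "\<P>(\<omega> in M. Z (Suc s) \<omega> = y \<and> H s \<omega> = h) \<le> \<P>(\<omega> in M. H s \<omega> = h)"
      by (intro finite_measure_mono) auto
    with 0 measure_nonneg[of M] show ?thesis by (simp add: order_antisym)
  qed
  have pair: "(\<lambda>\<omega>. (H s \<omega>, Z (Suc s) \<omega>)) \<in> measurable M (count_space (({..s} \<rightarrow>\<^sub>E E) \<times> E))"
  proof (subst measurable_count_space_eq2)
    show "finite (({..s} \<rightarrow>\<^sub>E E) \<times> E)" using fin assms(2) by simp
    have "(\<lambda>\<omega>. (H s \<omega>, Z (Suc s) \<omega>)) -` {(h,y)} \<inter> space M \<in> sets M"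
      if "h \<in> {..s} \<rightarrow>\<^sub>E E" "y \<in> E" for h y
    proof -
      have "(\<lambda>\<omega>. (H s \<omega>, Z (Suc s) \<omega>)) -` {(h,y)} \<inter> space M
          = (H s -` {h} \<inter> space M) \<inter> (Z (Suc s) -` {y} \<inter> space M)" by auto
      also have "\<dots> \<in> sets M" 
        by (rule sets.Int[OF measurable_sets[OF Hm] measurable_sets[OF Z]]) (use that in simp_all)
      finally show ?thesis .
    qed
    moreover have "(H s \<omega>, Z (Suc s) \<omega>) \<in> ({..s} \<rightarrow>\<^sub>E E) \<times> E" if "\<omega> \<in> space M" for \<omega>
      using measurable_space[OF Hm that, of s] measurable_space[OF Z that, of "Suc s"]
      by (simp only: space_count_space mem_Times_iff) simp
    ultimately show "(\<lambda>\<omega>. (H s \<omega>, Z (Suc s) \<omega>)) \<in> space M \<rightarrow> ({..s} \<rightarrow>\<^sub>E E) \<times> E \<and>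
      (\<forall>a\<in>({..s} \<rightarrow>\<^sub>E E) \<times> E. (\<lambda>\<omega>. (H s \<omega>, Z (Suc s) \<omega>)) -` {a} \<inter> space M \<in> sets M)"
      by (intro conjI ballI Pi_I) (auto simp only: mem_Times_iff split_paired_all fst_conv snd_conv)
  qed
  have "(\<integral>\<omega>. g (Z 0 \<omega>) * f (Z (Suc s) \<omega>) \<partial>M)
      = (\<integral>\<omega>. (\<lambda>(h,y). g (h 0) * f y) (H s \<omega>, Z (Suc s) \<omega>) \<partial>M)"
    by (simp add: H_def)
  also have "\<dots> = (\<Sum>a\<in>({..s} \<rightarrow>\<^sub>E E) \<times> E. (case a of (h,y) \<Rightarrow> g (h 0) * f y) *
      \<P>(\<omega> in M. (H s \<omega>, Z (Suc s) \<omega>) = a))"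
    by (rule finite_range_expectation(2)[OF prob_space_axioms _ pair]) (use fin assms(2) in simp)
  also have "\<dots> = (\<Sum>h\<in>{..s} \<rightarrow>\<^sub>E E. \<Sum>y\<in>E. g (h 0) * f y *
      \<P>(\<omega> in M. Z (Suc s) \<omega> = y \<and> H s \<omega> = h))"
    by (simp add: sum.cartesian_product conj_commute split_beta prod_eq_iff)
  also have "\<dots> = (\<Sum>h\<in>{..s} \<rightarrow>\<^sub>E E. g (h 0) * transition E P f (h s) * \<P>(\<omega> in M. H s \<omega> = h))"
    by (intro sum.cong refl) (simp add: step transition_def sum_distrib_left sum_distrib_right mult_ac)
  also have "\<dots> = (\<integral>\<omega>. (\<lambda>h. g (h 0) * transition E P f (h s)) (H s \<omega>) \<partial>M)"
    by (rule finite_range_expectation(2)[OF prob_space_axioms fin Hm, symmetric])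
  also have "\<dots> = (\<integral>\<omega>. g (Z 0 \<omega>) * transition E P f (Z s \<omega>) \<partial>M)"
    by (simp add: H_def)
  finally show ?thesis .
qed

text \<open>Iterating \<open>markov_one_step\<close> moves the whole evolution onto \<open>f\<close> at time \<open>0\<close>, where the law is known to be \<open>\<mu>\<close>.\<close>

lemma markov_two_time_expectation:
  fixes f g :: "'s \<Rightarrow> real"
  assumes "stationary_markov_chain E \<mu> P M Z" "finite E"
  shows "(\<integral>\<omega>. g (Z 0 \<omega>) * f (Z s \<omega>) \<partial>M) = (\<Sum>x\<in>E. \<mu> x * (g x * (transition E P ^^ s) f x))"
proof (induction s arbitrary: f)
  case 0
  have "prob_space M" "Z 0 \<in> measurable M (count_space E)" "\<forall>x\<in>E. \<P>(\<omega> in M. Z 0 \<omega> = x) = \<mu> x"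
    using assms(1) by (auto simp: stationary_markov_chain_def)
  then show ?case
    using finite_range_expectation(2)[OF _ assms(2), of M "Z 0" "\<lambda>x. g x * f x"]
    by (simp add: mult_ac)
next
  case (Suc s)
  then show ?case
    by (simp add: markov_one_step[OF assms] funpow_swap1)
qed

section \<open>Eigenfunctions of dynamical percolation\<close>

definition bit_mean :: "real \<Rightarrow> (int \<Rightarrow> real) \<Rightarrow> real" where
  "bit_mean p g = (1 - p) * g (-1) + p * g 1"

lemma finite_configs: "finite B \<Longrightarrow> finite (configs B)"
  by (simp add: configs_def finite_PiE)

text \<open>Bits are independent, so the expectation of a product of functions of single bits factorizes.\<close>

lemma perc_weight_product:
  assumes "finite B"
  shows "(\<Sum>x\<in>configs B. perc_weight p B x * (\<Prod>i\<in>B. g i (x i))) = (\<Prod>i\<in>B. bit_mean p (g i))"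
proof -
  have "(\<Sum>x\<in>configs B. perc_weight p B x * (\<Prod>i\<in>B. g i (x i)))
      = (\<Sum>x\<in>B \<rightarrow>\<^sub>E {-1,1}. \<Prod>i\<in>B. bit_weight p (x i) * g i (x i))"
    by (simp add: configs_def perc_weight_def prod.distrib)
  also have "\<dots> = (\<Prod>i\<in>B. \<Sum>c\<in>{-1,1}. bit_weight p c * g i c)"
    by (rule prod_sum_PiE[symmetric]) (use assms in auto)
  finally show ?thesis by (simp add: bit_weight_def bit_mean_def)
qed

text \<open>Resampling bit \<open>i\<close> replaces the factor of \<open>i\<close> by its mean and leaves the other factors alone; the kernel averages this over \<open>i\<close>.\<close>

lemma transition_product:
  assumes "finite B" "x \<in> configs B"
  shows "transition (configs B) (perc_kernel p B) (\<lambda>y. \<Prod>i\<in>B. g i (y i)) x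
    = (\<Sum>i\<in>B. bit_mean p (g i) * (\<Prod>j\<in>B - {i}. g j (x j))) / real (card B)"
proof -
  have x: "x j \<in> {-1,1}" if "j \<in> B" for j using assms(2) that by (auto simp: configs_def)
  have resample: "(\<Sum>y\<in>configs B. bit_weight p (y i) * (\<Prod>j\<in>B - {i}. of_bool (y j = x j)) * (\<Prod>j\<in>B. g j (y j)))
      = bit_mean p (g i) * (\<Prod>j\<in>B - {i}. g j (x j))" if i: "i \<in> B" for i
  proof -
    \<comment> \<open>Conditioning the other bits to keep their values turns the resampled weight into a product over all bits.\<close>
    define h where "h j c = (if j = i then bit_weight p c else of_bool (c = x j)) * g j c" for j c
    have "bit_weight p (y i) * (\<Prod>j\<in>B - {i}. of_bool (y j = x j)) * (\<Prod>j\<in>B. g j (y j)) = (\<Prod>j\<in>B. h j (y j))" for y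
    proof -
      have "(\<Prod>j\<in>B. h j (y j)) = (\<Prod>j\<in>B. if j = i then bit_weight p (y j) else of_bool (y j = x j)) * (\<Prod>j\<in>B. g j (y j))"
        by (simp add: h_def prod.distrib)
      also have "(\<Prod>j\<in>B. if j = i then bit_weight p (y j) else of_bool (y j = x j))
          = bit_weight p (y i) * (\<Prod>j\<in>B - {i}. of_bool (y j = x j))"
        by (subst prod.remove[OF assms(1) i]) (auto intro!: arg_cong2[of _ _ _ _ "(*)"] prod.cong)
      finally show ?thesis by simp
    qed
    then have "(\<Sum>y\<in>configs B. bit_weight p (y i) * (\<Prod>j\<in>B - {i}. of_bool (y j = x j)) * (\<Prod>j\<in>B. g j (y j)))
        = (\<Sum>y\<in>B \<rightarrow>\<^sub>E {-1,1}. \<Prod>j\<in>B. h j (y j))" by (simp add: configs_def)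
    also have "\<dots> = (\<Prod>j\<in>B. \<Sum>c\<in>{-1,1}. h j c)"
      by (rule prod_sum_PiE[symmetric]) (use assms in auto)
    also have "\<dots> = (\<Sum>c\<in>{-1,1}. h i c) * (\<Prod>j\<in>B - {i}. \<Sum>c\<in>{-1,1}. h j c)"
      by (rule prod.remove[OF assms(1) i])
    also have "(\<Sum>c\<in>{-1,1}. h i c) = bit_mean p (g i)"
      by (simp add: h_def bit_weight_def bit_mean_def)
    also have "(\<Prod>j\<in>B - {i}. \<Sum>c\<in>{-1,1}. h j c) = (\<Prod>j\<in>B - {i}. g j (x j))"
    proof (intro prod.cong refl)
      fix j assume j: "j \<in> B - {i}"
      with x[of j] consider "x j = -1" | "x j = 1" by auto
      then show "(\<Sum>c\<in>{-1,1}. h j c) = g j (x j)" using j by cases (simp_all add: h_def)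
    qed
    finally show ?thesis .
  qed
  have "transition (configs B) (perc_kernel p B) (\<lambda>y. \<Prod>i\<in>B. g i (y i)) x
      = (\<Sum>y\<in>configs B. \<Sum>i\<in>B. bit_weight p (y i) * (\<Prod>j\<in>B - {i}. of_bool (y j = x j)) * (\<Prod>j\<in>B. g j (y j))) / real (card B)"
    by (simp add: transition_def perc_kernel_def sum_distrib_right[symmetric] sum_divide_distrib[symmetric])
  also have "\<dots> = (\<Sum>i\<in>B. bit_mean p (g i) * (\<Prod>j\<in>B - {i}. g j (x j))) / real (card B)"
    by (subst sum.swap) (simp add: resample)
  finally show ?thesis .
qed

definition all_open :: "'b set \<Rightarrow> ('b \<Rightarrow> int) \<Rightarrow> real" where
  "all_open A x = (\<Prod>e\<in>A. of_bool (x e = 1))"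

text \<open>For \<open>p \<in> (0,1)\<close> these products, normalized, form the Fourier-Walsh basis of the biased cube.\<close>

definition centred :: "real \<Rightarrow> 'b set \<Rightarrow> ('b \<Rightarrow> int) \<Rightarrow> real" where
  "centred p A x = (\<Prod>e\<in>A. of_bool (x e = 1) - p)"

lemma prod_restrict_to_superset:
  fixes h :: "'b \<Rightarrow> real"
  assumes "finite B" "A \<subseteq> B"
  shows "(\<Prod>i\<in>A. h i) = (\<Prod>i\<in>B. if i \<in> A then h i else 1)"
  using assms by (subst prod.inter_restrict[symmetric]) (auto simp: Int_absorb1)

lemma transition_cong:
  "(\<And>y. y \<in> E \<Longrightarrow> f y = g y) \<Longrightarrow> transition E P f x = transition E P g x"
  by (simp add: transition_def)

lemma transition_sum:
  "transition E P (\<lambda>y. \<Sum>i\<in>I. c i * f i y) x = (\<Sum>i\<in>I. c i * transition E P (f i) x)"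
  unfolding transition_def
  by (simp add: sum_distrib_left sum.swap[of _ E I] mult_ac)

text \<open>Resampling a bit of \<open>A\<close> kills the product, because its factor has mean \<open>0\<close>, while resampling a bit outside \<open>A\<close> does nothing. The eigenvalue is the probability of the latter.\<close>

lemma transition_centred:
  assumes "finite B" "A \<subseteq> B" "B \<noteq> {}" "x \<in> configs B"
  shows "transition (configs B) (perc_kernel p B) (centred p A) x
    = (1 - real (card A) / real (card B)) * centred p A x"
proof -
  define g where "g i c = (if i \<in> A then of_bool (c = (1::int)) - p else 1)" for i c
  have c: "centred p A = (\<lambda>y. \<Prod>i\<in>B. g i (y i))"
    by (rule ext) (simp add: centred_def g_def prod_restrict_to_superset[OF assms(1,2)])
  have m: "bit_mean p (g i) = of_bool (i \<notin> A)" for i by (simp add: bit_mean_def g_def)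
  have r: "(\<Prod>j\<in>B - {i}. g j (x j)) = (\<Prod>j\<in>B. g j (x j))" if "i \<in> B - A" for i
    using that assms(1) prod.remove[of B i "\<lambda>j. g j (x j)"] by (simp add: g_def)
  have "(\<Sum>i\<in>B. bit_mean p (g i) * (\<Prod>j\<in>B - {i}. g j (x j))) = (\<Sum>i\<in>B - A. (\<Prod>j\<in>B - {i}. g j (x j)))"
    using assms(1) by (intro sum.mono_neutral_cong_right) (auto simp: m)
  also have "\<dots> = (\<Sum>i\<in>B - A. \<Prod>j\<in>B. g j (x j))" by (intro sum.cong refl r)
  also have "\<dots> = (real (card B) - real (card A)) * (\<Prod>j\<in>B. g j (x j))"
    using assms by (simp add: card_Diff_subset finite_subset of_nat_diff card_mono)
  finally have *: "(\<Sum>i\<in>B. bit_mean p (g i) * (\<Prod>j\<in>B - {i}. g j (x j))) = (real (card B) - real (card A)) * (\<Prod>j\<in>B. g j (x j))" .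
  have "card B \<noteq> 0" using assms by auto
  then show ?thesis
    unfolding c transition_product[OF assms(1,4)] * by (simp add: field_simps)
qed

text \<open>Multiply out \<open>(of_bool (x e = 1) - p) + p\<close>.\<close>

lemma all_open_expand:
  assumes "finite A"
  shows "all_open A x = (\<Sum>A'\<in>Pow A. p ^ (card A - card A') * centred p A' x)"
proof -
  have "all_open A x = (\<Prod>e\<in>A. (of_bool (x e = 1) - p) + p)" by (simp add: all_open_def)
  also have "\<dots> = (\<Sum>A'\<in>Pow A. (\<Prod>e\<in>A'. of_bool (x e = 1) - p) * (\<Prod>e\<in>A - A'. p))"
    using assms by (rule prod_add)
  also have "\<dots> = (\<Sum>A'\<in>Pow A. p ^ (card A - card A') * centred p A' x)"
    using assms by (intro sum.cong refl) (auto simp: centred_def card_Diff_subset finite_subset)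
  finally show ?thesis .
qed

lemma transition_power_all_open:
  assumes "finite B" "A \<subseteq> B" "B \<noteq> {}" "x \<in> configs B"
  shows "(transition (configs B) (perc_kernel p B) ^^ s) (all_open A) x
    = (\<Sum>A'\<in>Pow A. p ^ (card A - card A') * (1 - real (card A') / real (card B)) ^ s * centred p A' x)"
  using assms(4)
proof (induction s arbitrary: x)
  case 0
  then show ?case using assms by (simp add: all_open_expand[of A x p] finite_subset)
next
  case (Suc s)
  have "(transition (configs B) (perc_kernel p B) ^^ Suc s) (all_open A) x
      = transition (configs B) (perc_kernel p B) (\<lambda>y. \<Sum>A'\<in>Pow A.
          (p ^ (card A - card A') * (1 - real (card A') / real (card B)) ^ s) * centred p A' y) x"
    using Suc.IH by (auto intro: transition_cong)
  also have "\<dots> = (\<Sum>A'\<in>Pow A. (p ^ (card A - card A') * (1 - real (card A') / real (card B)) ^ s) *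
      ((1 - real (card A') / real (card B)) * centred p A' x))"
    unfolding transition_sum using assms Suc.prems
    by (intro sum.cong refl arg_cong2[of _ _ _ _ "(*)"] transition_centred) auto
  finally show ?case by (simp add: mult_ac)
qed

text \<open>A bit of \<open>A'\<close> outside \<open>A\<close> contributes a centred factor, of mean \<open>0\<close>. A bit in both contributes \<open>p * (1 - p)\<close>, as \<open>\<omega> * (\<omega> - p) = \<omega> * (1 - p)\<close> for \<open>\<omega> \<in> {0,1}\<close>.\<close>

lemma all_open_centred_expectation:
  assumes "finite B" "A \<subseteq> B" "A' \<subseteq> B"
  shows "(\<Sum>x\<in>configs B. perc_weight p B x * (all_open A x * centred p A' x))
    = (if A' \<subseteq> A then p ^ card A * (1 - p) ^ card A' else 0)"
proof -
  define g where "g i c = (if i \<in> A then of_bool (c = (1::int)) else 1) * (if i \<in> A' then of_bool (c = 1) - p else 1)" for i c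
  have "all_open A x * centred p A' x = (\<Prod>i\<in>B. g i (x i))" for x
    by (simp add: all_open_def centred_def g_def prod.distrib
        prod_restrict_to_superset[OF assms(1,2)] prod_restrict_to_superset[OF assms(1,3)])
  then have "(\<Sum>x\<in>configs B. perc_weight p B x * (all_open A x * centred p A' x)) = (\<Prod>i\<in>B. bit_mean p (g i))"
    by (simp add: perc_weight_product[OF assms(1)])
  also have "\<dots> = (if A' \<subseteq> A then p ^ card A * (1 - p) ^ card A' else 0)"
  proof (cases "A' \<subseteq> A")
    case True
    have "(\<Prod>i\<in>B. bit_mean p (g i)) = (\<Prod>i\<in>B. (if i \<in> A then p else 1) * (if i \<in> A' then 1 - p else 1))"
      using True by (intro prod.cong refl) (auto simp: bit_mean_def g_def)
    also have "\<dots> = (\<Prod>i\<in>A. p) * (\<Prod>i\<in>A'. 1 - p)"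
      by (subst (1 2) prod_restrict_to_superset[OF assms(1)]) (use assms in \<open>simp_all add: prod.distrib\<close>)
    finally show ?thesis using True by simp
  next
    case False
    then obtain i where i: "i \<in> A'" "i \<notin> A" by auto
    have "bit_mean p (g i) = 0" using i by (simp add: bit_mean_def g_def)
    with i assms have "(\<Prod>i\<in>B. bit_mean p (g i)) = 0" by (intro prod_zero) auto
    with False show ?thesis by simp
  qed
  finally show ?thesis .
qed

text \<open>The expectation of \<open>g K\<close> on the event \<open>K \<ge> 1\<close>, where \<open>K\<close> is binomial with parameters \<open>h\<close> and \<open>1 - p\<close>. The value \<open>K = 0\<close> is left out since it corresponds to the constant eigenfunction, which does not enter covariances.\<close>

definition binomial_sum :: "real \<Rightarrow> nat \<Rightarrow> (nat \<Rightarrow> real) \<Rightarrow> real" where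
  "binomial_sum p h g = (\<Sum>k=1..h. real (h choose k) * p ^ (h - k) * (1 - p) ^ k * g k)"

lemma sum_over_subsets_by_card:
  fixes F :: "nat \<Rightarrow> real"
  assumes "finite A"
  shows "(\<Sum>A'\<in>Pow A. F (card A')) = (\<Sum>k\<le>card A. real (card A choose k) * F k)"
proof -
  have "(\<Sum>A'\<in>Pow A. F (card A')) = (\<Sum>k\<le>card A. \<Sum>A'\<in>{A'\<in>Pow A. card A' = k}. F (card A'))"
    using assms by (intro sum.group[symmetric]) (auto intro: card_mono)
  also have "\<dots> = (\<Sum>k\<le>card A. real (card A choose k) * F k)"
  proof (intro sum.cong refl)
    fix k
    have "(\<Sum>A'\<in>{A'\<in>Pow A. card A' = k}. F (card A')) = real (card {A'\<in>Pow A. card A' = k}) * F k" by simp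
    also have "card {A'\<in>Pow A. card A' = k} = card A choose k"
      using n_subsets[OF assms, of k] by simp
    finally show "(\<Sum>A'\<in>{A'\<in>Pow A. card A' = k}. F (card A')) = real (card A choose k) * F k" .
  qed
  finally show ?thesis .
qed

text \<open>Only eigenfunctions supported on the common part \<open>A1 \<inter> A2\<close> survive. The empty set gives the product of the two expectations; the others, sorted by cardinality, give the covariance as a binomial sum.\<close>

lemma all_open_two_time:
  assumes "finite B" "A1 \<subseteq> B" "A2 \<subseteq> B" "B \<noteq> {}"
  shows "(\<Sum>x\<in>configs B. perc_weight p B x * (all_open A1 x *
            (transition (configs B) (perc_kernel p B) ^^ s) (all_open A2) x))
    = p ^ card A1 * p ^ card A2 + p ^ (card A1 + card A2 - card (A1 \<inter> A2)) *
        binomial_sum p (card (A1 \<inter> A2)) (\<lambda>k. (1 - real k / real (card B)) ^ s)"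
proof -
  define h where "h = card (A1 \<inter> A2)"
  define l where "l k = (1 - real k / real (card B)) ^ s" for k
  have fin: "finite A1" "finite A2" using assms finite_subset by auto
  have h_le: "h \<le> card A1" "h \<le> card A2" using fin by (auto simp: h_def intro: card_mono)
  have "(\<Sum>x\<in>configs B. perc_weight p B x * (all_open A1 x *
            (transition (configs B) (perc_kernel p B) ^^ s) (all_open A2) x))
     = (\<Sum>x\<in>configs B. \<Sum>A\<in>Pow A2. p ^ (card A2 - card A) * l (card A) * (perc_weight p B x * (all_open A1 x * centred p A x)))"
    by (intro sum.cong refl) (simp add: transition_power_all_open[OF assms(1,3,4)] l_def sum_distrib_left mult_ac)
  also have "\<dots> = (\<Sum>A\<in>Pow A2. p ^ (card A2 - card A) * l (card A) *
      (\<Sum>x\<in>configs B. perc_weight p B x * (all_open A1 x * centred p A x)))"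
    by (subst sum.swap) (simp add: sum_distrib_left)
  also have "\<dots> = (\<Sum>A\<in>Pow A2. p ^ (card A2 - card A) * l (card A) *
      (if A \<subseteq> A1 then p ^ card A1 * (1 - p) ^ card A else 0))"
    using assms by (intro sum.cong refl) (subst all_open_centred_expectation; auto)
  also have "\<dots> = (\<Sum>A\<in>Pow (A1 \<inter> A2). p ^ (card A2 - card A) * l (card A) * (p ^ card A1 * (1 - p) ^ card A))"
    using fin by (intro sum.mono_neutral_cong_right) auto
  also have "\<dots> = (\<Sum>k\<le>h. real (h choose k) * (p ^ (card A2 - k) * l k * (p ^ card A1 * (1 - p) ^ k)))"
    unfolding h_def using fin by (intro sum_over_subsets_by_card) auto
  also have "\<dots> = (\<Sum>k\<in>insert 0 {1..h}. real (h choose k) * (p ^ (card A2 - k) * l k * (p ^ card A1 * (1 - p) ^ k)))"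
    by (intro sum.cong) auto
  also have "\<dots> = p ^ card A1 * p ^ card A2 +
      (\<Sum>k=1..h. real (h choose k) * (p ^ (card A2 - k) * l k * (p ^ card A1 * (1 - p) ^ k)))"
    by (subst sum.insert) (auto simp: l_def)
  also have "(\<Sum>k=1..h. real (h choose k) * (p ^ (card A2 - k) * l k * (p ^ card A1 * (1 - p) ^ k)))
      = p ^ (card A1 + card A2 - h) * binomial_sum p h l"
    unfolding binomial_sum_def sum_distrib_left
  proof (intro sum.cong refl)
    fix k assume k: "k \<in> {1..h}"
    then have "card A1 + (card A2 - k) = (card A1 + card A2 - h) + (h - k)" using h_le by simp
    then have "p ^ card A1 * p ^ (card A2 - k) = p ^ (card A1 + card A2 - h) * p ^ (h - k)"
      by (simp only: power_add[symmetric])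
    then show "real (h choose k) * (p ^ (card A2 - k) * l k * (p ^ card A1 * (1 - p) ^ k))
        = p ^ (card A1 + card A2 - h) * (real (h choose k) * p ^ (h - k) * (1 - p) ^ k * l k)"
      by (simp add: algebra_simps)
  qed
  finally show ?thesis by (simp add: h_def l_def[abs_def])
qed

section \<open>Paths and clusters in the binary tree\<close>

text \<open>Edges correspond to nonempty vertices through their lower endpoint. This turns sets of edges into sets of lists, and shared edges into common prefixes.\<close>

definition edge_above :: "bool list \<Rightarrow> bool list set" where
  "edge_above w = {butlast w, w}"

definition path_edges :: "bool list \<Rightarrow> bool list set set" where
  "path_edges v = edge_above ` {w. prefix w v \<and> w \<noteq> []}"

lemma inj_on_edge_above: "inj_on edge_above {w. w \<noteq> []}"
proof (rule inj_onI)
  fix v w :: "bool list"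
  assume vw: "v \<in> {w. w \<noteq> []}" "w \<in> {w. w \<noteq> []}" and "edge_above v = edge_above w"
  then consider "v = w" | "v = butlast w" "w = butlast v"
    unfolding edge_above_def doubleton_eq_iff by blast
  then show "v = w"
  proof cases
    case 2
    then have "length v = length w - 1" "length w = length v - 1" by (metis length_butlast)+
    with vw show ?thesis by simp
  qed
qed

lemma tree_edges_eq: "tree_edges n = edge_above ` {w. w \<noteq> [] \<and> length w \<le> n}"
proof (intro equalityI subsetI)
  fix e assume "e \<in> tree_edges n"
  then obtain v b where "e = {v, v @ [b]}" "length (v @ [b]) \<le> n"
    by (auto simp: tree_edges_def tree_verts_def)
  then show "e \<in> edge_above ` {w. w \<noteq> [] \<and> length w \<le> n}"
    by (intro image_eqI[of _ _ "v @ [b]"]) (auto simp: edge_above_def)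
next
  fix e assume "e \<in> edge_above ` {w. w \<noteq> [] \<and> length w \<le> n}"
  then obtain w where w: "w \<noteq> []" "length w \<le> n" "e = {butlast w, w}" by (auto simp: edge_above_def)
  then have "e = {butlast w, butlast w @ [last w]}" by simp
  with w show "e \<in> tree_edges n" unfolding tree_edges_def tree_verts_def
    by (intro CollectI exI[of _ "butlast w"] exI[of _ "last w"]) auto
qed

lemma finite_tree_verts: "finite (tree_verts n)"
  using finite_lists_length_le[of "UNIV :: bool set" n] by (simp add: tree_verts_def)

lemma finite_tree_edges: "finite (tree_edges n)"
  unfolding tree_edges_eq
  by (intro finite_imageI finite_subset[OF _ finite_tree_verts[of n]]) (auto simp: tree_verts_def)

lemma prefix_set_Nil: "{w. prefix w v \<and> w \<noteq> []} = set (prefixes v) - {[]}"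
  by auto

lemma finite_path_edges: "finite (path_edges v)"
  unfolding path_edges_def prefix_set_Nil by simp

lemma card_path_edges: "card (path_edges v) = length v"
proof -
  have "card (path_edges v) = card {w. prefix w v \<and> w \<noteq> []}"
    unfolding path_edges_def by (intro card_image inj_on_subset[OF inj_on_edge_above]) auto
  also have "\<dots> = card (set (prefixes v)) - 1"
    unfolding prefix_set_Nil by (subst card_Diff_singleton) auto
  also have "\<dots> = length v" by (simp add: distinct_card)
  finally show ?thesis .
qed

lemma path_edges_Int: "path_edges u \<inter> path_edges v = path_edges (longest_common_prefix u v)"
proof -
  have "path_edges u \<inter> path_edges v = edge_above ` ({w. prefix w u \<and> w \<noteq> []} \<inter> {w. prefix w v \<and> w \<noteq> []})"
    unfolding path_edges_def by (intro inj_on_image_Int[OF inj_on_edge_above, symmetric]) auto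
  also have "{w. prefix w u \<and> w \<noteq> []} \<inter> {w. prefix w v \<and> w \<noteq> []} = {w. prefix w (longest_common_prefix u v) \<and> w \<noteq> []}"
    by (auto intro: longest_common_prefix_max_prefix longest_common_prefix_prefix1
        longest_common_prefix_prefix2 elim: prefix_order.trans)
  finally show ?thesis by (simp add: path_edges_def)
qed

lemma path_edges_subset: "v \<in> tree_verts n \<Longrightarrow> path_edges v \<subseteq> tree_edges n"
  unfolding path_edges_def tree_edges_eq tree_verts_def
  by (auto dest: prefix_length_le)

lemma depth_le_card_tree_edges: "n \<le> card (tree_edges n)"
proof -
  have "replicate n True \<in> tree_verts n" by (simp add: tree_verts_def)
  from card_mono[OF finite_tree_edges path_edges_subset[OF this]]
  show ?thesis by (simp add: card_path_edges)
qed

lemma path_edges_snoc: "path_edges (v @ [b]) = insert {v, v @ [b]} (path_edges v)"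
proof -
  have "{w. prefix w (v @ [b]) \<and> w \<noteq> []} = insert (v @ [b]) {w. prefix w v \<and> w \<noteq> []}"
    by (auto simp: prefix_snoc)
  then show ?thesis by (simp add: path_edges_def edge_above_def)
qed

lemma path_edges_Nil: "path_edges [] = {}"
  by (auto simp: path_edges_def)

text \<open>Walking along open edges, each step either descends, appending an open edge to the path, or climbs, removing the last one; both keep the path from the root open.\<close>

lemma root_connected_iff_path_open:
  assumes "v \<in> tree_verts n"
  shows "([], v) \<in> (open_adj (tree_edges n) x)\<^sup>* \<longleftrightarrow> (\<forall>e\<in>path_edges v. x e = 1)"
proof
  assume "([], v) \<in> (open_adj (tree_edges n) x)\<^sup>*"
  then show "\<forall>e\<in>path_edges v. x e = 1"
  proof (induction rule: rtrancl_induct)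
    case base
    show ?case by (simp add: path_edges_Nil)
  next
    case (step u w)
    then have "{u, w} \<in> tree_edges n" and o: "x {u, w} = 1" by (auto simp: open_adj_def)
    then obtain v b where "{u, w} = {v, v @ [b]}" by (auto simp: tree_edges_def)
    then consider "w = u @ [b]" | "u = w @ [b]" by (auto simp: doubleton_eq_iff)
    then show ?case
      using step.IH o by cases (auto simp: path_edges_snoc insert_commute)
  qed
next
  assume "\<forall>e\<in>path_edges v. x e = 1"
  with assms show "([], v) \<in> (open_adj (tree_edges n) x)\<^sup>*"
  proof (induction v rule: rev_induct)
    case Nil
    then show ?case by simp
  next
    case (snoc b v)
    then have "([], v) \<in> (open_adj (tree_edges n) x)\<^sup>*"
      by (auto simp: path_edges_snoc tree_verts_def)
    moreover have "(v, v @ [b]) \<in> open_adj (tree_edges n) x"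
      using snoc.prems by (auto simp: open_adj_def path_edges_snoc tree_edges_def tree_verts_def)
    ultimately show ?case by (rule rtrancl_into_rtrancl)
  qed
qed

lemma equiv_connected: "equiv V ((open_adj B x)\<^sup>* \<inter> V \<times> V)"
proof (rule equivI)
  have "sym (open_adj B x)" by (auto simp: sym_def open_adj_def insert_commute)
  then show "sym ((open_adj B x)\<^sup>* \<inter> V \<times> V)"
    by (auto intro!: symI dest: symD[OF sym_rtrancl])
  show "refl_on V ((open_adj B x)\<^sup>* \<inter> V \<times> V)" by (auto simp: refl_on_def)
  show "trans ((open_adj B x)\<^sup>* \<inter> V \<times> V)" by (auto simp: trans_def)
  show "(open_adj B x)\<^sup>* \<inter> V \<times> V \<subseteq> V \<times> V" by auto
qed

lemma cluster_size_eq: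
  assumes "v \<in> V"
  shows "cluster_size V B v x = real (card {w \<in> V. (v, w) \<in> (open_adj B x)\<^sup>*})"
proof -
  let ?R = "(open_adj B x)\<^sup>* \<inter> V \<times> V"
  have "(THE C. C \<in> clusters V B x \<and> v \<in> C) = ?R `` {v}"
  proof (rule the_equality)
    show "?R `` {v} \<in> clusters V B x \<and> v \<in> ?R `` {v}"
      using assms by (auto simp: clusters_def intro: quotientI)
    fix C assume "C \<in> clusters V B x \<and> v \<in> C"
    then obtain u where u: "C = ?R `` {u}" and v: "(u, v) \<in> ?R"
      by (auto simp: clusters_def elim!: quotientE)
    show "C = ?R `` {v}"
      unfolding u by (rule equiv_class_eq[OF equiv_connected v])
  qed
  also have "?R `` {v} = {w \<in> V. (v, w) \<in> (open_adj B x)\<^sup>*}" using assms by auto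
  finally show ?thesis by (simp add: cluster_size_def)
qed

lemma root_cluster_size_eq:
  "root_cluster_size n x = (\<Sum>v\<in>tree_verts n. all_open (path_edges v) x)"
proof -
  have "root_cluster_size n x = real (card {w \<in> tree_verts n. ([], w) \<in> (open_adj (tree_edges n) x)\<^sup>*})"
    unfolding root_cluster_size_def by (rule cluster_size_eq) (simp add: tree_verts_def)
  also have "{w \<in> tree_verts n. ([], w) \<in> (open_adj (tree_edges n) x)\<^sup>*} = {w \<in> tree_verts n. \<forall>e\<in>path_edges w. x e = 1}"
    using root_connected_iff_path_open by blast
  also have "real (card \<dots>) = (\<Sum>v\<in>tree_verts n. of_bool (\<forall>e\<in>path_edges v. x e = 1))"
    by (simp add: sum_of_bool_eq finite_tree_verts Int_def)
  also have "\<dots> = (\<Sum>v\<in>tree_verts n. all_open (path_edges v) x)"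
  proof (intro sum.cong refl)
    fix v
    show "of_bool (\<forall>e\<in>path_edges v. x e = 1) = all_open (path_edges v) x"
      using finite_path_edges[of v] by (auto simp: all_open_def intro!: prod.neutral prod_zero[symmetric])
  qed
  finally show ?thesis .
qed

section \<open>Pairs of vertices sorted by their meet\<close>

text \<open>The sum of \<open>p ^ length v\<close> over all vertices \<open>v\<close> of the tree of depth \<open>n\<close>, that is, the mean size of the root cluster (see \<open>sum_power_length\<close>).\<close>

definition branch_sum :: "real \<Rightarrow> nat \<Rightarrow> real" where
  "branch_sum p n = (\<Sum>j\<le>n. (2 * p) ^ j)"

text \<open>The sum of \<open>p ^ (length u + length v)\<close> over ordered pairs of vertices of the tree of depth \<open>n\<close> that have only the empty prefix in common. With \<open>S = branch_sum p n\<close>, pairs involving the root contribute \<open>2 * S - 1\<close>. For the remaining pairs, the two vertices lie below different children of the root, each subtree having total weight \<open>(S - 1) / 2\<close>, so they contribute \<open>(S - 1)^2 / 2\<close>.\<close>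

definition meet_sum :: "real \<Rightarrow> nat \<Rightarrow> real" where
  "meet_sum p n = ((branch_sum p n)\<^sup>2 + 2 * branch_sum p n - 1) / 2"

text \<open>The weight of \<open>h\<close> is the total weight of the pairs whose meet has depth \<open>h\<close>: there are \<open>2 ^ h\<close> such meets, the common path counts once, and below the meet there is a tree of depth \<open>n - h\<close>.\<close>

definition tree_sum :: "real \<Rightarrow> nat \<Rightarrow> (nat \<Rightarrow> real) \<Rightarrow> real" where
  "tree_sum p n \<psi> = (\<Sum>h\<le>n. (2 * p) ^ h * meet_sum p (n - h) * \<psi> h)"

lemma tree_verts_Suc:
  "tree_verts (Suc n) = insert [] (Cons False ` tree_verts n \<union> Cons True ` tree_verts n)"
proof (intro equalityI subsetI)
  fix v assume "v \<in> tree_verts (Suc n)"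
  then show "v \<in> insert [] (Cons False ` tree_verts n \<union> Cons True ` tree_verts n)"
    by (cases v; cases "hd v") (auto simp: tree_verts_def)
qed (auto simp: tree_verts_def)

lemma sum_tree_verts_Suc:
  fixes F :: "bool list \<Rightarrow> real"
  shows "(\<Sum>v\<in>tree_verts (Suc n). F v) = F [] + (\<Sum>v\<in>tree_verts n. F (False # v)) + (\<Sum>v\<in>tree_verts n. F (True # v))"
proof -
  have "(\<Sum>v\<in>tree_verts (Suc n). F v) = F [] + (\<Sum>v\<in>Cons False ` tree_verts n \<union> Cons True ` tree_verts n. F v)"
    unfolding tree_verts_Suc by (subst sum.insert) (auto simp: finite_tree_verts)
  also have "(\<Sum>v\<in>Cons False ` tree_verts n \<union> Cons True ` tree_verts n. F v)
      = (\<Sum>v\<in>Cons False ` tree_verts n. F v) + (\<Sum>v\<in>Cons True ` tree_verts n. F v)"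
    by (intro sum.union_disjoint) (auto simp: finite_tree_verts)
  finally show ?thesis by (simp add: sum.reindex)
qed

lemma tree_verts_0: "tree_verts 0 = {[]}"
  by (auto simp: tree_verts_def)

lemma branch_sum_Suc: "branch_sum p (Suc n) = 1 + 2 * p * branch_sum p n"
  unfolding branch_sum_def by (subst sum.atMost_Suc_shift) (simp add: sum_distrib_left)

lemma sum_power_length: "(\<Sum>v\<in>tree_verts n. p ^ length v) = branch_sum p n"
proof (induction n)
  case 0
  then show ?case by (simp add: tree_verts_0 branch_sum_def)
next
  case (Suc n)
  then show ?case
    by (simp add: sum_tree_verts_Suc branch_sum_Suc sum_distrib_left[symmetric])
qed

lemma tree_sum_Suc: "tree_sum p (Suc n) \<psi> = meet_sum p (Suc n) * \<psi> 0 + 2 * p * tree_sum p n (\<lambda>h. \<psi> (Suc h))"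
  unfolding tree_sum_def by (subst sum.atMost_Suc_shift) (simp add: sum_distrib_left mult_ac)

text \<open>Induction on the depth. Pairs below the same child of the root reduce to the smaller tree with \<open>\<psi>\<close> shifted by one, and all other pairs meet at the root.\<close>

lemma sum_over_vertex_pairs:
  "(\<Sum>u\<in>tree_verts n. \<Sum>v\<in>tree_verts n.
      p ^ (length u + length v - length (longest_common_prefix u v)) *
      \<psi> (length (longest_common_prefix u v))) = tree_sum p n \<psi>"
proof (induction n arbitrary: \<psi>)
  case 0
  then show ?case by (simp add: tree_verts_0 tree_sum_def meet_sum_def branch_sum_def)
next
  case (Suc n)
  define F where "F \<psi> u v = p ^ (length u + length v - length (longest_common_prefix u v)) *
      \<psi> (length (longest_common_prefix u v))" for \<psi> :: "nat \<Rightarrow> real" and u v :: "bool list"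
  define S where "S = branch_sum p n"
  have lcp: "length (longest_common_prefix u v) \<le> length u" for u v :: "bool list"
    by (rule prefix_length_le) (rule longest_common_prefix_prefix1)
  have root1: "F \<psi> [] v = p ^ length v * \<psi> 0" for v by (simp add: F_def)
  have root2: "F \<psi> v [] = p ^ length v * \<psi> 0" for v
    using longest_common_prefix_prefix2[of v "[]"] by (simp add: F_def)
  have same: "F \<psi> (b # u) (b # v) = p * F (\<lambda>h. \<psi> (Suc h)) u v" for b u v
    using lcp[of u v] by (simp add: F_def Suc_diff_le)
  have diff: "F \<psi> (b # u) (c # v) = p * p ^ length u * (p * p ^ length v) * \<psi> 0" if "b \<noteq> c" for b c u v
    using that by (simp add: F_def power_add)
  have IH: "(\<Sum>u\<in>tree_verts n. \<Sum>v\<in>tree_verts n. F (\<lambda>h. \<psi> (Suc h)) u v) = tree_sum p n (\<lambda>h. \<psi> (Suc h))"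
    using Suc.IH by (simp add: F_def)
  have cross: "(\<Sum>u\<in>tree_verts n. \<Sum>v\<in>tree_verts n. F \<psi> (b # u) (c # v)) = p\<^sup>2 * S\<^sup>2 * \<psi> 0" if "b \<noteq> c" for b c
  proof -
    have "(\<Sum>u\<in>tree_verts n. \<Sum>v\<in>tree_verts n. F \<psi> (b # u) (c # v))
        = (\<Sum>u\<in>tree_verts n. p ^ length u) * (\<Sum>v\<in>tree_verts n. p ^ length v) * p\<^sup>2 * \<psi> 0"
      by (simp add: diff[OF that] sum_distrib_left sum_distrib_right power2_eq_square mult_ac)
    then show ?thesis by (simp add: sum_power_length S_def power2_eq_square)
  qed
  have diag: "(\<Sum>u\<in>tree_verts n. \<Sum>v\<in>tree_verts n. F \<psi> (b # u) (b # v)) = p * tree_sum p n (\<lambda>h. \<psi> (Suc h))" for b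
    by (simp add: same sum_distrib_left[symmetric] IH)
  have edge: "(\<Sum>v\<in>tree_verts n. F \<psi> [] (b # v)) = p * S * \<psi> 0"
             "(\<Sum>v\<in>tree_verts n. F \<psi> (b # v) []) = p * S * \<psi> 0" for b
    by (simp_all add: root1 root2 S_def sum_power_length[symmetric] sum_distrib_left[symmetric] sum_distrib_right[symmetric])
  have "(\<Sum>u\<in>tree_verts (Suc n). \<Sum>v\<in>tree_verts (Suc n). F \<psi> u v)
      = (1 + 4 * p * S + 2 * p\<^sup>2 * S\<^sup>2) * \<psi> 0 + 2 * p * tree_sum p n (\<lambda>h. \<psi> (Suc h))"
    by (simp add: sum_tree_verts_Suc sum.distrib cross diag edge root1[of "[]"] algebra_simps)
  also have "1 + 4 * p * S + 2 * p\<^sup>2 * S\<^sup>2 = meet_sum p (Suc n)"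
    by (simp add: meet_sum_def branch_sum_Suc S_def power2_eq_square algebra_simps)
  finally show ?case by (simp add: tree_sum_Suc F_def)
qed

section \<open>The autocorrelations as binomial mixtures\<close>

lemma transition_power_sum:
  "(transition E P ^^ s) (\<lambda>y. \<Sum>i\<in>I. f i y) = (\<lambda>x. \<Sum>i\<in>I. (transition E P ^^ s) (f i) x)"
proof (induction s)
  case (Suc s)
  have "transition E P (\<lambda>y. \<Sum>i\<in>I. (transition E P ^^ s) (f i) y) x
      = (\<Sum>i\<in>I. transition E P ((transition E P ^^ s) (f i)) x)" for x
    using transition_sum[where c = "\<lambda>_. 1" and f = "\<lambda>i. (transition E P ^^ s) (f i)"] by simp
  with Suc show ?case by simp
qed simp

lemma binomial_sum_0: "binomial_sum p 0 g = 0"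
  by (simp add: binomial_sum_def)

text \<open>Up to normalization, the integral of \<open>g\<close> against the spectral measure of the root cluster size: mass at \<open>k \<ge> 1\<close> belongs to the eigenvalue \<open>1 - k/m\<close>.\<close>

definition spectral_sum :: "real \<Rightarrow> nat \<Rightarrow> (nat \<Rightarrow> real) \<Rightarrow> real" where
  "spectral_sum p n g = tree_sum p n (\<lambda>h. binomial_sum p h g)"

lemma covariance_expand:
  assumes "prob_space M" "integrable M X" "integrable M Y" "integrable M (\<lambda>\<omega>. X \<omega> * Y \<omega>)"
  shows "cov M X Y = (\<integral>\<omega>. X \<omega> * Y \<omega> \<partial>M) - integral\<^sup>L M X * integral\<^sup>L M Y"
proof -
  interpret prob_space M by fact
  have "cov M X Y = (\<integral>\<omega>. X \<omega> * Y \<omega> - integral\<^sup>L M Y * X \<omega> - integral\<^sup>L M X * Y \<omega> +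
      integral\<^sup>L M X * integral\<^sup>L M Y \<partial>M)"
    unfolding cov_def by (intro Bochner_Integration.integral_cong refl) (simp add: algebra_simps)
  then show ?thesis using assms by (simp add: prob_space)
qed

lemma root_cluster_covariance:
  assumes "dynamical_percolation p (tree_edges n) M Z" "n \<ge> 1"
  shows "cov M (\<lambda>\<omega>. root_cluster_size n (Z 0 \<omega>)) (\<lambda>\<omega>. root_cluster_size n (Z s \<omega>))
    = spectral_sum p n (\<lambda>k. (1 - real k / real (card (tree_edges n))) ^ s)"
proof -
  let ?B = "tree_edges n" and ?V = "tree_verts n"
  let ?E = "configs ?B" and ?T = "transition (configs ?B) (perc_kernel p ?B)"
  define f where "f = root_cluster_size n"
  define l where "l k = (1 - real k / real (card (tree_edges n))) ^ s" for k
  have f: "f = (\<lambda>x. \<Sum>v\<in>?V. all_open (path_edges v) x)"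
    by (rule ext) (simp add: f_def root_cluster_size_eq)
  have chain: "stationary_markov_chain ?E (perc_weight p ?B) (perc_kernel p ?B) M Z"
    using assms(1) by (simp add: dynamical_percolation_def)
  then interpret prob_space M by (simp add: stationary_markov_chain_def)
  have Zm: "Z s \<in> measurable M (count_space ?E)" for s
    using chain by (simp add: stationary_markov_chain_def)
  note finE = finite_configs[OF finite_tree_edges[of n]]
  have ne: "?B \<noteq> {}" using depth_le_card_tree_edges[of n] assms(2) by force
  have sub: "path_edges v \<subseteq> ?B" if "v \<in> ?V" for v by (rule path_edges_subset[OF that])
  note two_time = markov_two_time_expectation[OF chain finE]
  have int_f: "integrable M (\<lambda>\<omega>. f (Z s \<omega>))" for s
    by (rule finite_range_expectation(1)[OF prob_space_axioms finE Zm])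
  have bdd: "\<bar>f (Z s \<omega>)\<bar> \<le> (\<Sum>x\<in>?E. \<bar>f x\<bar>)" if "\<omega> \<in> space M" for s \<omega>
    using finE measurable_space[OF Zm that, of s] by (intro member_le_sum) auto
  \<comment> \<open>The state space is finite, so \<open>f\<close> is bounded along the chain.\<close>
  have int_ff: "integrable M (\<lambda>\<omega>. f (Z 0 \<omega>) * f (Z s \<omega>))"
  proof (rule Bochner_Integration.integrable_bound[of _ "\<lambda>\<omega>. (\<Sum>x\<in>?E. \<bar>f x\<bar>) * f (Z s \<omega>)"])
    show "integrable M (\<lambda>\<omega>. (\<Sum>x\<in>?E. \<bar>f x\<bar>) * f (Z s \<omega>))" using int_f by simp
    show "(\<lambda>\<omega>. f (Z 0 \<omega>) * f (Z s \<omega>)) \<in> borel_measurable M"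
      by (intro borel_measurable_times borel_measurable_integrable int_f)
    have nn: "0 \<le> (\<Sum>x\<in>?E. \<bar>f x\<bar>)" by (simp add: sum_nonneg)
    show "AE \<omega> in M. norm (f (Z 0 \<omega>) * f (Z s \<omega>)) \<le> norm ((\<Sum>x\<in>?E. \<bar>f x\<bar>) * f (Z s \<omega>))"
    proof (rule AE_I2)
      fix \<omega> assume "\<omega> \<in> space M"
      then have "\<bar>f (Z 0 \<omega>)\<bar> * \<bar>f (Z s \<omega>)\<bar> \<le> (\<Sum>x\<in>?E. \<bar>f x\<bar>) * \<bar>f (Z s \<omega>)\<bar>"
        using bdd by (intro mult_right_mono) auto
      with nn show "norm (f (Z 0 \<omega>) * f (Z s \<omega>)) \<le> norm ((\<Sum>x\<in>?E. \<bar>f x\<bar>) * f (Z s \<omega>))"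
        by (simp add: abs_mult)
    qed
  qed
  have mean: "(\<integral>\<omega>. f (Z s \<omega>) \<partial>M) = (\<Sum>v\<in>?V. p ^ length v)" for s
  proof -
    have "(\<integral>\<omega>. f (Z s \<omega>) \<partial>M) = (\<Sum>x\<in>?E. perc_weight p ?B x * (?T ^^ s) f x)"
      using two_time[of "\<lambda>_. 1" f s] by simp
    also have "\<dots> = (\<Sum>v\<in>?V. \<Sum>x\<in>?E. perc_weight p ?B x * (all_open {} x * (?T ^^ s) (all_open (path_edges v)) x))"
      unfolding f transition_power_sum by (simp add: sum_distrib_left all_open_def[of "{}"] sum.swap[of _ ?E])
    also have "\<dots> = (\<Sum>v\<in>?V. p ^ length v)"
      by (intro sum.cong refl)
        (simp add: all_open_two_time[OF finite_tree_edges _ sub ne] card_path_edges binomial_sum_0)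
    finally show ?thesis .
  qed
  have "(\<integral>\<omega>. f (Z 0 \<omega>) * f (Z s \<omega>) \<partial>M) = (\<Sum>x\<in>?E. perc_weight p ?B x * (f x * (?T ^^ s) f x))"
    by (rule two_time)
  also have "\<dots> = (\<Sum>x\<in>?E. \<Sum>u\<in>?V. \<Sum>v\<in>?V. perc_weight p ?B x *
      (all_open (path_edges u) x * (?T ^^ s) (all_open (path_edges v)) x))"
    unfolding f transition_power_sum sum_product by (simp add: sum_distrib_left)
  also have "\<dots> = (\<Sum>u\<in>?V. \<Sum>v\<in>?V. \<Sum>x\<in>?E. perc_weight p ?B x *
      (all_open (path_edges u) x * (?T ^^ s) (all_open (path_edges v)) x))"
    by (subst sum.swap, intro sum.cong refl, subst sum.swap) simp
  also have "\<dots> = (\<Sum>u\<in>?V. \<Sum>v\<in>?V. p ^ length u * p ^ length v +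
      p ^ (length u + length v - length (longest_common_prefix u v)) *
      binomial_sum p (length (longest_common_prefix u v)) l)"
    by (intro sum.cong refl)
      (simp add: all_open_two_time[OF finite_tree_edges sub sub ne] path_edges_Int card_path_edges l_def[abs_def])
  also have "\<dots> = (\<Sum>v\<in>?V. p ^ length v) * (\<Sum>v\<in>?V. p ^ length v) + spectral_sum p n l"
    by (simp add: sum.distrib sum_product spectral_sum_def sum_over_vertex_pairs[symmetric])
  finally show ?thesis
    using covariance_expand[OF prob_space_axioms int_f[of 0] int_f[of s] int_ff]
    by (simp add: mean f_def[symmetric] l_def[abs_def])
qed

corollary root_cluster_autocorr:
  assumes "dynamical_percolation p (tree_edges n) M Z" "n \<ge> 1"
  shows "autocorr M Z (root_cluster_size n) s
    = spectral_sum p n (\<lambda>k. (1 - real k / real (card (tree_edges n))) ^ s) / spectral_sum p n (\<lambda>_. 1)"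
proof -
  have "prob_space.variance M (\<lambda>\<omega>. root_cluster_size n (Z 0 \<omega>)) = spectral_sum p n (\<lambda>_. 1)"
    using root_cluster_covariance[OF assms, of 0] by (simp add: cov_def power2_eq_square)
  then show ?thesis by (simp add: autocorr_def root_cluster_covariance[OF assms])
qed

text \<open>In this form the dependence on \<open>g\<close> is visibly linear. For \<open>p \<in> (0,1)\<close> it is also monotone, the coefficients of \<open>g k\<close> with \<open>1 \<le> k \<le> n\<close> being nonnegative.\<close>

lemma spectral_sum_alt:
  "spectral_sum p n g = (\<Sum>h\<le>n. \<Sum>k=1..h.
     ((2 * p) ^ h * meet_sum p (n - h) * real (h choose k) * p ^ (h - k) * (1 - p) ^ k) * g k)"
  by (simp add: spectral_sum_def tree_sum_def binomial_sum_def sum_distrib_left mult_ac)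

lemma branch_sum_ge_1: "0 < p \<Longrightarrow> 1 \<le> branch_sum p n"
  unfolding branch_sum_def using member_le_sum[of 0 "{..n}" "\<lambda>j. (2 * p) ^ j"] by simp

lemma meet_sum_pos: "0 < p \<Longrightarrow> 0 < meet_sum p n"
  using branch_sum_ge_1[of p n] unfolding meet_sum_def by (smt (verit) zero_le_power2 divide_pos_pos)

lemma spectral_sum_mono:
  assumes "0 < p" "p < 1" "\<And>k. 1 \<le> k \<Longrightarrow> k \<le> n \<Longrightarrow> g k \<le> g' k"
  shows "spectral_sum p n g \<le> spectral_sum p n g'"
  unfolding spectral_sum_alt using assms meet_sum_pos[of p]
  by (intro sum_mono mult_left_mono mult_nonneg_nonneg) (auto simp: less_imp_le)

lemma spectral_sum_cong:
  "(\<And>k. 1 \<le> k \<Longrightarrow> k \<le> n \<Longrightarrow> g k = g' k) \<Longrightarrow> spectral_sum p n g = spectral_sum p n g'"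
  unfolding spectral_sum_alt by (intro sum.cong refl) auto

lemma spectral_sum_linear:
  "spectral_sum p n (\<lambda>k. c * g k) = c * spectral_sum p n g"
  "spectral_sum p n (\<lambda>k. g k - g' k) = spectral_sum p n g - spectral_sum p n g'"
  unfolding spectral_sum_alt
  by (simp_all add: sum_distrib_left sum_subtractf algebra_simps)

text \<open>The probability generating function of the binomial distribution without its term of order \<open>0\<close>.\<close>

lemma binomial_sum_power:
  "binomial_sum p h (\<lambda>k. x ^ k) = (p + (1 - p) * x) ^ h - p ^ h"
proof -
  have "(p + (1 - p) * x) ^ h = ((1 - p) * x + p) ^ h" by (simp add: add.commute)
  also have "\<dots> = (\<Sum>k\<le>h. real (h choose k) * ((1 - p) * x) ^ k * p ^ (h - k))"
    by (rule binomial_ring)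
  also have "\<dots> = (\<Sum>k\<in>insert 0 {1..h}. real (h choose k) * ((1 - p) * x) ^ k * p ^ (h - k))"
    by (intro sum.cong) auto
  also have "\<dots> = p ^ h + binomial_sum p h (\<lambda>k. x ^ k)"
    by (subst sum.insert) (auto simp: binomial_sum_def power_mult_distrib mult_ac intro!: sum.cong)
  finally show ?thesis by simp
qed

lemma binomial_sum_const: "binomial_sum p h (\<lambda>_. 1) = 1 - p ^ h"
  using binomial_sum_power[of p h 1] by simp

text \<open>The variance of the root cluster size. The term \<open>h = 1\<close> alone is already positive.\<close>

lemma spectral_sum_1_pos:
  assumes "0 < p" "p < 1" "n \<ge> 1"
  shows "0 < spectral_sum p n (\<lambda>_. 1)"
proof -
  have "0 < (2 * p) ^ 1 * meet_sum p (n - 1) * (1 - p ^ 1)"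
    using assms meet_sum_pos[of p "n - 1"] by simp
  also have "\<dots> \<le> (\<Sum>h\<le>n. (2 * p) ^ h * meet_sum p (n - h) * (1 - p ^ h))"
    using assms meet_sum_pos[of p] 
    by (intro member_le_sum[where f = "\<lambda>h. (2 * p) ^ h * meet_sum p (n - h) * (1 - p ^ h)" and i = 1])
       (auto simp: less_imp_le power_le_one)
  finally show ?thesis by (simp add: spectral_sum_def tree_sum_def binomial_sum_const)
qed

text \<open>The nonnegative integers give \<open>1 / (1 - x)\<close> and the negative ones \<open>x / (1 - x)\<close>.\<close>

lemma two_sided_geometric_has_sum:
  assumes "0 \<le> (x::real)" "x < 1"
  shows "((\<lambda>s::int. x ^ nat \<bar>s\<bar>) has_sum (2 / (1 - x) - 1)) UNIV"
proof -
  have geo: "((\<lambda>s::nat. x ^ s) has_sum (1 / (1 - x))) UNIV"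
    using assms by (intro sums_nonneg_imp_has_sum geometric_sums) auto
  have pos: "((\<lambda>s::int. x ^ nat \<bar>s\<bar>) has_sum (1 / (1 - x))) (int ` UNIV)"
    using geo by (subst has_sum_reindex) (auto simp: o_def inj_on_def)
  have "((\<lambda>s::int. x ^ nat \<bar>s\<bar>) has_sum (x * (1 / (1 - x)))) ((\<lambda>s. - int (Suc s)) ` UNIV)"
  proof (subst has_sum_reindex)
    show "inj (\<lambda>s. - int (Suc s))" by (auto simp: inj_on_def)
    have "(\<lambda>s. x ^ nat \<bar>- int (Suc s)\<bar>) = (\<lambda>s. x * x ^ s)"
      by (intro ext) (simp add: nat_add_distrib)
    then show "((\<lambda>s. x ^ nat \<bar>s\<bar>) \<circ> (\<lambda>s. - int (Suc s)) has_sum x * (1 / (1 - x))) UNIV"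
      using has_sum_cmult_right[OF geo, of x] by (simp add: o_def)
  qed
  moreover have "int ` UNIV \<inter> (\<lambda>s. - int (Suc s)) ` UNIV = {}" by auto
  ultimately
  have "((\<lambda>s::int. x ^ nat \<bar>s\<bar>) has_sum (1 / (1 - x) + x * (1 / (1 - x)))) (int ` UNIV \<union> (\<lambda>s. - int (Suc s)) ` UNIV)"
    by (rule has_sum_Un_disjoint[OF pos])
  also have "int ` UNIV \<union> (\<lambda>s. - int (Suc s)) ` UNIV = UNIV"
  proof (intro equalityI subsetI UnCI)
    fix s :: int assume "s \<notin> (\<lambda>s. - int (Suc s)) ` UNIV"
    then have "s \<ge> 0" by (cases s rule: int_cases) auto
    then show "s \<in> int ` UNIV" by (metis nonneg_int_cases rangeI)
  qed simp
  also have "1 / (1 - x) + x * (1 / (1 - x)) = 2 / (1 - x) - 1"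
    using assms by (simp add: field_simps)
  finally show ?thesis .
qed

lemma has_sum_finite_sum:
  fixes F :: "'i \<Rightarrow> 'a \<Rightarrow> real"
  assumes "finite I" "\<And>i. i \<in> I \<Longrightarrow> (F i has_sum S i) A"
  shows "((\<lambda>x. \<Sum>i\<in>I. F i x) has_sum (\<Sum>i\<in>I. S i)) A"
  using assms by (induction I rule: finite_induct) (auto intro!: has_sum_add)

text \<open>For the eigenvalue \<open>x = 1 - k/m\<close> the two-sided geometric series sums to \<open>2m/k - 1\<close>, and half of this is averaged over \<open>k\<close>.\<close>

lemma root_cluster_autocorr_time:
  assumes "dynamical_percolation p (tree_edges n) M Z" "n \<ge> 1" "0 < p" "p < 1"
  shows "autocorr_time M Z (root_cluster_size n) / real (card (tree_edges n))
    = spectral_sum p n (\<lambda>k. 1 / real k) / spectral_sum p n (\<lambda>_. 1) - 1 / (2 * real (card (tree_edges n)))"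
proof -
  define m where "m = real (card (tree_edges n))"
  define R where "R = spectral_sum p n (\<lambda>_. 1)"
  have m: "real n \<le> m" "0 < m" using depth_le_card_tree_edges[of n] assms(2) by (auto simp: m_def)
  have R: "R > 0" unfolding R_def using assms by (intro spectral_sum_1_pos)
  have "((\<lambda>s::int. spectral_sum p n (\<lambda>k. (1 - real k / m) ^ nat \<bar>s\<bar>)) has_sum
      spectral_sum p n (\<lambda>k. 2 / (1 - (1 - real k / m)) - 1)) UNIV"
    unfolding spectral_sum_alt using m
    by (intro has_sum_finite_sum has_sum_cmult_right two_sided_geometric_has_sum) (auto simp: field_simps)
  from has_sum_cmult_right[OF this, of "1 / R"]
  have "((\<lambda>s::int. autocorr M Z (root_cluster_size n) (nat \<bar>s\<bar>)) has_sum
      1 / R * spectral_sum p n (\<lambda>k. 2 / (1 - (1 - real k / m)) - 1)) UNIV"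
    by (simp add: root_cluster_autocorr[OF assms(1,2)] R_def m_def)
  then have "autocorr_time M Z (root_cluster_size n)
      = 1 / 2 * (1 / R * spectral_sum p n (\<lambda>k. 2 / (1 - (1 - real k / m)) - 1))"
    by (simp add: autocorr_time_def infsumI)
  also have "spectral_sum p n (\<lambda>k. 2 / (1 - (1 - real k / m)) - 1) = spectral_sum p n (\<lambda>k. 2 * m * (1 / real k) - 1)"
    by (intro spectral_sum_cong) simp
  also have "\<dots> = 2 * m * spectral_sum p n (\<lambda>k. 1 / real k) - R"
    by (simp only: spectral_sum_linear R_def)
  finally show ?thesis
    using m R by (simp add: R_def[symmetric] m_def[symmetric] field_simps)
qed

section \<open>Reciprocals of binomial variables\<close>

abbreviation mean_reciprocal :: "real \<Rightarrow> nat \<Rightarrow> real" where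
  "mean_reciprocal p h \<equiv> binomial_sum p h (\<lambda>k. 1 / real k)"

text \<open>Pascal's rule splits the sum in two. In one part the binomial coefficients are those of \<open>h\<close>; in the other, \<open>(h choose (k - 1)) / k = (Suc h choose k) / Suc h\<close> removes the reciprocal.\<close>

lemma mean_reciprocal_Suc:
  "mean_reciprocal p (Suc h) = p * mean_reciprocal p h + (1 - p ^ Suc h) / real (Suc h)"
proof -
  define q where "q = 1 - p"
  have term_eq: "real (Suc h choose k) * p ^ (Suc h - k) * q ^ k * (1 / real k)
      = real (h choose k) * p ^ (Suc h - k) * q ^ k * (1 / real k)
        + (real (Suc h choose k) * p ^ (Suc h - k) * q ^ k * 1) / real (Suc h)" if k: "k \<in> {1..Suc h}" for k
  proof -
    obtain j where j: "k = Suc j" using k by (cases k) auto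
    have "real (Suc h) * real (h choose j) = real (Suc h choose Suc j) * real (Suc j)"
      by (simp only: of_nat_mult[symmetric] Suc_times_binomial_eq)
    then have "real (h choose j) / real k = real (Suc h choose k) / real (Suc h)"
      unfolding j by (simp add: field_simps del: binomial_Suc_Suc)
    moreover have "real (Suc h choose k) = real (h choose k) + real (h choose j)" by (simp add: j)
    ultimately have "real (Suc h choose k) / real k = real (h choose k) / real k + real (Suc h choose k) / real (Suc h)"
      by (simp add: add_divide_distrib)
    then have "real (Suc h choose k) / real k * (p ^ (Suc h - k) * q ^ k)
       = (real (h choose k) / real k + real (Suc h choose k) / real (Suc h)) * (p ^ (Suc h - k) * q ^ k)"
      by (rule arg_cong)
    then show ?thesis by (simp add: ring_distribs mult_ac del: binomial_Suc_Suc of_nat_Suc)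
  qed
  have "mean_reciprocal p (Suc h) = (\<Sum>k=1..Suc h. real (h choose k) * p ^ (Suc h - k) * q ^ k * (1 / real k))
      + binomial_sum p (Suc h) (\<lambda>_. 1) / real (Suc h)"
    unfolding binomial_sum_def q_def[symmetric] sum_divide_distrib sum.distrib[symmetric]
    by (intro sum.cong refl term_eq)
  also have "(\<Sum>k=1..Suc h. real (h choose k) * p ^ (Suc h - k) * q ^ k * (1 / real k)) = p * mean_reciprocal p h"
    by (simp add: binomial_sum_def sum_distrib_left q_def Suc_diff_le mult_ac)
  finally show ?thesis by (simp add: binomial_sum_const)
qed

lemma binomial_sum_mono:
  assumes "0 < p" "p < 1" "\<And>k. 1 \<le> k \<Longrightarrow> k \<le> h \<Longrightarrow> g k \<le> g' k"
  shows "binomial_sum p h g \<le> binomial_sum p h g'"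
  unfolding binomial_sum_def using assms
  by (intro sum_mono mult_left_mono mult_nonneg_nonneg) auto

lemma mean_reciprocal_bounds:
  assumes "0 < p" "p < 1"
  shows "0 \<le> mean_reciprocal p h" "mean_reciprocal p h \<le> 1"
proof -
  show "0 \<le> mean_reciprocal p h"
    using binomial_sum_mono[OF assms, of h "\<lambda>_. 0" "\<lambda>k. 1 / real k"] by (simp add: binomial_sum_def)
  have "mean_reciprocal p h \<le> 1 - p ^ h"
    using binomial_sum_mono[OF assms, of h "\<lambda>k. 1 / real k" "\<lambda>_. 1"] by (simp add: binomial_sum_const)
  also have "\<dots> \<le> 1" using assms by simp
  finally show "mean_reciprocal p h \<le> 1" .
qed

text \<open>The recursion for the coefficients multiplies the generating function by \<open>r * p\<close> up to two logarithmic series, which leaves a linear equation for its value.\<close>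

lemma mean_reciprocal_generating_function:
  assumes "0 < p" "p < 1" "0 < r" "r < 1"
  shows "(\<lambda>h. r ^ h * mean_reciprocal p h) sums (ln ((1 - r * p) / (1 - r)) / (1 - r * p))"
proof -
  \<comment> \<open>For \<open>h = 0\<close> the mean reciprocal is the empty sum \<open>0\<close>, so shifting the series does not change its value.\<close>
  define G where "G h = r ^ h * mean_reciprocal p h" for h
  have rp: "0 < r * p" "r * p < 1" using assms mult_strict_mono[of r 1 p 1] by auto
  have log_series: "(\<lambda>h. x ^ Suc h / real (Suc h)) sums (- ln (1 - x))" if "0 < x" "x < 1" for x :: real
  proof -
    have "(\<lambda>n. - (- ((- (- x)) ^ n) / real n)) sums (- ln (1 - x))"
      using sums_minus[OF ln_series'[of "-x"]] that by simp
    then show ?thesis by (subst sums_Suc_iff) simp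
  qed
  have "summable G"
  proof (rule summable_comparison_test')
    show "summable (\<lambda>h. r ^ h)" using assms by simp
    show "norm (G h) \<le> r ^ h" if "h \<ge> 0" for h
      using assms mean_reciprocal_bounds[OF assms(1,2), of h] by (simp add: G_def mult_left_le)
  qed
  then obtain F where F: "G sums F" by (auto simp: summable_def)
  have "(\<lambda>h. r * p * G h + (r ^ Suc h / real (Suc h) - (r * p) ^ Suc h / real (Suc h)))
      sums (r * p * F + (- ln (1 - r) - - ln (1 - r * p)))"
    by (intro sums_add sums_diff sums_mult F log_series assms rp)
  moreover have "r * p * G h + (r ^ Suc h / real (Suc h) - (r * p) ^ Suc h / real (Suc h)) = G (Suc h)" for h
    by (simp add: G_def mean_reciprocal_Suc power_mult_distrib algebra_simps diff_divide_distrib del: of_nat_Suc)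
  ultimately have "(\<lambda>h. G (Suc h)) sums (r * p * F + (ln (1 - r * p) - ln (1 - r)))" by simp
  moreover have "(\<lambda>h. G (Suc h)) sums F"
    using F by (subst sums_Suc_iff) (simp add: G_def binomial_sum_0)
  ultimately have "F = r * p * F + (ln (1 - r * p) - ln (1 - r))" by (rule sums_unique2[symmetric])
  then have "F = (ln (1 - r * p) - ln (1 - r)) / (1 - r * p)" using rp by (simp add: field_simps)
  also have "ln (1 - r * p) - ln (1 - r) = ln ((1 - r * p) / (1 - r))"
    using rp assms by (simp add: ln_div)
  finally show ?thesis using F by (simp add: G_def[abs_def])
qed

section \<open>Limits away from criticality\<close>

text \<open>Off criticality \<open>meet_sum p n\<close> grows like \<open>L * b ^ n\<close>. Dividing by \<open>b ^ n\<close>, the weight of \<open>h\<close> becomes \<open>(2 * p / b) ^ h\<close> times a bounded sequence in \<open>n - h\<close> that converges to \<open>L\<close>, and Tannery's theorem applies.\<close>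

lemma tree_sum_limit:
  assumes "0 < p" "0 < b" and lim: "(\<lambda>n. meet_sum p n / b ^ n) \<longlonglongrightarrow> L"
    and summ: "summable (\<lambda>h. (2 * p / b) ^ h * \<bar>\<phi> h\<bar>)"
  shows "(\<lambda>n. tree_sum p n \<phi> / b ^ n) \<longlonglongrightarrow> L * (\<Sum>h. (2 * p / b) ^ h * \<phi> h)"
proof -
  define r where "r = 2 * p / b"
  have r: "0 \<le> r" using assms by (simp add: r_def)
  define a where "a h n = (if h \<le> n then r ^ h * \<phi> h * (meet_sum p (n - h) / b ^ (n - h)) else 0)" for h n
  obtain C where C: "\<And>n. norm (meet_sum p n / b ^ n) \<le> C"
    using convergent_imp_Bseq[OF convergentI[OF lim]] by (auto simp: Bseq_def)
  have C0: "0 \<le> C" using C[of 0] norm_ge_zero order_trans by blast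
  have suminf_a: "(\<Sum>h. a h n) = tree_sum p n \<phi> / b ^ n" for n
  proof -
    have "(\<Sum>h. a h n) = (\<Sum>h\<le>n. a h n)" by (rule suminf_finite) (auto simp: a_def)
    also have "\<dots> = tree_sum p n \<phi> / b ^ n"
      unfolding tree_sum_def sum_divide_distrib
    proof (intro sum.cong refl)
      fix h assume "h \<in> {..n}"
      then have "b ^ n = b ^ h * b ^ (n - h)" by (simp add: power_add[symmetric])
      with \<open>h \<in> {..n}\<close> show "a h n = (2 * p) ^ h * meet_sum p (n - h) * \<phi> h / b ^ n"
        by (simp add: a_def r_def power_divide)
    qed
    finally show ?thesis .
  qed
  have lim_a: "a h \<longlonglongrightarrow> r ^ h * \<phi> h * L" for h
  proof (rule Lim_transform_eventually)
    show "(\<lambda>n. r ^ h * \<phi> h * (meet_sum p (n - h) / b ^ (n - h))) \<longlonglongrightarrow> r ^ h * \<phi> h * L"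
      by (intro tendsto_mult tendsto_const filterlim_compose[OF lim] filterlim_minus_const_nat_at_top)
    show "eventually (\<lambda>n. r ^ h * \<phi> h * (meet_sum p (n - h) / b ^ (n - h)) = a h n) sequentially"
      using eventually_ge_at_top[of h] by eventually_elim (simp add: a_def)
  qed
  have bound: "norm (a h n) \<le> r ^ h * \<bar>\<phi> h\<bar> * C" for h n
  proof (cases "h \<le> n")
    case True
    then have "norm (a h n) = r ^ h * \<bar>\<phi> h\<bar> * norm (meet_sum p (n - h) / b ^ (n - h))"
      using r by (simp add: a_def abs_mult)
    also have "\<dots> \<le> r ^ h * \<bar>\<phi> h\<bar> * C" using r by (intro mult_left_mono C) simp
    finally show ?thesis .
  qed (use C0 r in \<open>simp add: a_def\<close>)
  have summ': "summable (\<lambda>h. r ^ h * \<bar>\<phi> h\<bar>)" using summ by (simp add: r_def)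
  have "eventually (\<lambda>(h, n). norm (a h n) \<le> r ^ h * \<bar>\<phi> h\<bar> * C) (at_top \<times>\<^sub>F sequentially)"
    by (intro always_eventually allI case_prodI2 bound)
  from tannerys_theorem[OF lim_a this summable_mult2[OF summ'] sequentially_bot]
  have "(\<lambda>n. \<Sum>h. a h n) \<longlonglongrightarrow> (\<Sum>h. r ^ h * \<phi> h * L)" by (elim conjE)
  also have "(\<Sum>h. r ^ h * \<phi> h * L) = L * (\<Sum>h. r ^ h * \<phi> h)"
  proof -
    have "summable (\<lambda>h. r ^ h * \<phi> h)"
      by (rule summable_norm_cancel) (use summ' r in \<open>simp add: abs_mult\<close>)
    then show ?thesis by (subst suminf_mult2[symmetric]) (simp_all add: mult.commute)
  qed
  finally show ?thesis by (simp add: suminf_a r_def)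
qed

text \<open>The ratio of the limiting geometric law of the depth of the meet. In the subcritical case only meets near the root matter because deeper ones are unlikely to be reached; in the supercritical case, because the number of pairs below a meet shrinks with its depth.\<close>

definition meet_ratio :: "real \<Rightarrow> real" where
  "meet_ratio p = (if p < 1/2 then 2 * p else 1 / (2 * p))"

lemma meet_ratio_bounds: "0 < p \<Longrightarrow> p \<noteq> 1/2 \<Longrightarrow> 0 < meet_ratio p \<and> meet_ratio p < 1"
  by (auto simp: meet_ratio_def field_simps)

text \<open>The subcritical mean cluster size converges, so \<open>b = 1\<close>; the supercritical one grows like \<open>(2p) ^ n\<close>, so that pairs need \<open>b = (2p)^2\<close>. In both cases \<open>2p/b\<close> is \<open>meet_ratio p\<close>.\<close>

lemma meet_sum_limit:
  assumes "0 < p" "p \<noteq> 1/2"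
  shows "\<exists>b L. 0 < b \<and> 0 < L \<and> 2 * p / b = meet_ratio p \<and> (\<lambda>n. meet_sum p n / b ^ n) \<longlonglongrightarrow> L"
proof (cases "p < 1/2")
  case True
  define S where "S = 1 / (1 - 2 * p)"
  define L where "L = (S\<^sup>2 + 2 * S - 1) / 2"
  have S: "(\<lambda>n. branch_sum p n) \<longlonglongrightarrow> S"
    unfolding branch_sum_def sums_def_le[symmetric] S_def by (rule geometric_sums) (use True assms in simp)
  have lim: "(\<lambda>n. meet_sum p n) \<longlonglongrightarrow> L"
    unfolding meet_sum_def L_def by (intro tendsto_divide tendsto_diff tendsto_add tendsto_mult tendsto_power S tendsto_const) simp
  have "1 \<le> S" using True assms by (simp add: S_def field_simps)
  then have "0 < (2 * S - 1) + S\<^sup>2" by (intro add_pos_nonneg) auto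
  then have "0 < L" by (simp add: L_def algebra_simps)
  with lim True have "0 < (1::real) \<and> 0 < L \<and> 2 * p / 1 = meet_ratio p \<and> (\<lambda>n. meet_sum p n / 1 ^ n) \<longlonglongrightarrow> L"
    by (simp add: meet_ratio_def)
  then show ?thesis by blast
next
  case False
  then have p: "1 < 2 * p" using assms by auto
  define t where "t = 1 / (2 * p)"
  define c where "c = 2 * p / (2 * p - 1)"
  have t: "0 < t" "t < 1" "2 * p * t = 1" using p by (auto simp: t_def)
  then have tn: "(\<lambda>n. t ^ n) \<longlonglongrightarrow> 0" by (intro LIMSEQ_realpow_zero) auto
  have ptn: "(2 * p) ^ n * t ^ n = 1" for n
    by (simp only: power_mult_distrib[symmetric] t(3) power_one)
  define B where "B n = branch_sum p n * t ^ n" for n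
  have B_eq: "B n = (2 * p - t ^ n) / (2 * p - 1)" for n
  proof -
    have "branch_sum p n = ((2 * p) ^ Suc n - 1) / (2 * p - 1)"
      unfolding branch_sum_def lessThan_Suc_atMost[symmetric] by (rule geometric_sum) (use p in simp)
    then have "B n = (2 * p * ((2 * p) ^ n * t ^ n) - t ^ n) / (2 * p - 1)"
      by (simp only: B_def power_Suc times_divide_eq_left left_diff_distrib mult_1 mult.assoc)
    then show ?thesis by (simp only: ptn mult_1_right)
  qed
  have "(\<lambda>n. (2 * p - t ^ n) / (2 * p - 1)) \<longlonglongrightarrow> (2 * p - 0) / (2 * p - 1)"
    using p by (intro tendsto_divide tendsto_diff tendsto_const tn) auto
  then have B: "B \<longlonglongrightarrow> c" by (simp add: B_eq[abs_def] c_def)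
  have scaled: "meet_sum p n / ((2 * p)\<^sup>2) ^ n = ((B n)\<^sup>2 + 2 * B n * t ^ n - (t ^ n)\<^sup>2) / 2" for n
  proof -
    have expand: "(s\<^sup>2 + 2 * s - 1) / 2 * x\<^sup>2 = ((s * x)\<^sup>2 + 2 * (s * x) * x - x\<^sup>2) / 2" for s x :: real
      by (simp add: power2_eq_square algebra_simps)
    have "(a\<^sup>2) ^ n * (b ^ n)\<^sup>2 = (a ^ n * b ^ n)\<^sup>2" for a b :: real
      by (simp only: power_mult_distrib power_mult[symmetric] mult.commute[of 2 n])
    from this[of "2 * p" t] have "((2 * p)\<^sup>2) ^ n * (t ^ n)\<^sup>2 = 1" by (simp only: ptn power_one)
    then have "meet_sum p n / ((2 * p)\<^sup>2) ^ n = meet_sum p n * (t ^ n)\<^sup>2"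
      by (simp only: divide_inverse inverse_unique)
    then show ?thesis by (simp only: meet_sum_def B_def expand)
  qed
  have "(\<lambda>n. ((B n)\<^sup>2 + 2 * B n * t ^ n - (t ^ n)\<^sup>2) / 2) \<longlonglongrightarrow> (c\<^sup>2 + 2 * c * 0 - 0\<^sup>2) / 2"
    by (intro tendsto_divide tendsto_diff tendsto_add tendsto_mult tendsto_power B tn tendsto_const) simp
  then have lim: "(\<lambda>n. meet_sum p n / ((2 * p)\<^sup>2) ^ n) \<longlonglongrightarrow> c\<^sup>2 / 2"
    unfolding scaled by simp
  have pos: "0 < c\<^sup>2 / 2" "0 < (2 * p)\<^sup>2" using p by (auto simp: c_def)
  have "2 * p / (2 * p)\<^sup>2 = meet_ratio p" using False p by (simp add: meet_ratio_def power2_eq_square)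
  with pos lim show ?thesis by blast
qed

lemma one_minus_power_generating_function:
  fixes p r :: real
  assumes "0 < p" "p < 1" "0 < r" "r < 1"
  shows "(\<lambda>h. r ^ h * (1 - p ^ h)) sums (r * (1 - p) / ((1 - r) * (1 - r * p)))"
proof -
  have rp: "0 < r * p" "r * p < 1" using assms mult_strict_mono[of r 1 p 1] by auto
  have "(\<lambda>h. r ^ h - (r * p) ^ h) sums (1 / (1 - r) - 1 / (1 - r * p))"
    using rp assms by (intro sums_diff geometric_sums) auto
  also have "1 / (1 - r) - 1 / (1 - r * p) = r * (1 - p) / ((1 - r) * (1 - r * p))"
    using rp assms by (simp add: field_simps)
  finally show ?thesis by (simp add: power_mult_distrib algebra_simps)
qed

text \<open>The scaling \<open>L * b ^ n\<close> cancels in the quotient, so that only the generating functions at \<open>meet_ratio p\<close> remain; that of the constant \<open>1\<close> is explicit.\<close>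

lemma off_critical_ratio:
  assumes "0 < p" "p < 1" "p \<noteq> 1/2" "summable (\<lambda>h. meet_ratio p ^ h * \<bar>binomial_sum p h g\<bar>)"
  shows "(\<lambda>n. spectral_sum p n g / spectral_sum p n (\<lambda>_. 1)) \<longlonglongrightarrow>
    (\<Sum>h. meet_ratio p ^ h * binomial_sum p h g) * ((1 - meet_ratio p) * (1 - meet_ratio p * p) / (meet_ratio p * (1 - p)))"
proof -
  define r where "r = meet_ratio p"
  have r: "0 < r" "r < 1" using meet_ratio_bounds[of p] assms by (auto simp: r_def)
  have rp: "r * p < 1" using r assms mult_strict_mono[of r 1 p 1] by auto
  obtain b L where b: "0 < b" "0 < L" "2 * p / b = r" and lim: "(\<lambda>n. meet_sum p n / b ^ n) \<longlonglongrightarrow> L"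
    using meet_sum_limit[OF assms(1,3)] by (auto simp: r_def)
  note gen = one_minus_power_generating_function[OF assms(1,2) r]
  define D where "D = r * (1 - p) / ((1 - r) * (1 - r * p))"
  have D: "D > 0" using r rp assms by (simp add: D_def)
  have nonneg: "\<bar>1 - p ^ h\<bar> = 1 - p ^ h" for h using assms power_le_one[of p h] by simp
  have "(\<lambda>n. spectral_sum p n (\<lambda>_. 1) / b ^ n) \<longlonglongrightarrow> L * (\<Sum>h. r ^ h * (1 - p ^ h))"
    unfolding spectral_sum_def binomial_sum_const b(3)[symmetric]
    by (rule tree_sum_limit[OF assms(1) b(1) lim]) (use gen in \<open>simp add: b(3) nonneg sums_iff\<close>)
  then have var: "(\<lambda>n. spectral_sum p n (\<lambda>_. 1) / b ^ n) \<longlonglongrightarrow> L * D"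
    using gen by (simp add: sums_iff D_def)
  have num: "(\<lambda>n. spectral_sum p n g / b ^ n) \<longlonglongrightarrow> L * (\<Sum>h. r ^ h * binomial_sum p h g)"
    unfolding spectral_sum_def b(3)[symmetric]
    by (rule tree_sum_limit[OF assms(1) b(1) lim]) (use assms(4) in \<open>simp add: b(3) r_def\<close>)
  have "(\<lambda>n. (spectral_sum p n g / b ^ n) / (spectral_sum p n (\<lambda>_. 1) / b ^ n)) \<longlonglongrightarrow>
      L * (\<Sum>h. r ^ h * binomial_sum p h g) / (L * D)"
    using b D by (intro tendsto_divide num var) auto
  also have "L * (\<Sum>h. r ^ h * binomial_sum p h g) / (L * D) = (\<Sum>h. r ^ h * binomial_sum p h g) * (1 / D)"
    using b by simp
  also have "1 / D = (1 - r) * (1 - r * p) / (r * (1 - p))" by (simp add: D_def)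
  finally show ?thesis using b by (simp add: r_def)
qed

lemma off_critical_mean_reciprocal:
  assumes "0 < p" "p < 1" "p \<noteq> 1/2"
  shows "(\<lambda>n. spectral_sum p n (\<lambda>k. 1 / real k) / spectral_sum p n (\<lambda>_. 1)) \<longlonglongrightarrow>
    (1 - meet_ratio p) / (meet_ratio p * (1 - p)) * ln ((1 - meet_ratio p * p) / (1 - meet_ratio p))"
proof -
  have r: "0 < meet_ratio p" "meet_ratio p < 1" using meet_ratio_bounds[of p] assms by auto
  have rp: "meet_ratio p * p < 1" using r assms mult_strict_mono[of "meet_ratio p" 1 p 1] by auto
  note gen = mean_reciprocal_generating_function[OF assms(1,2) r]
  have "summable (\<lambda>h. meet_ratio p ^ h * \<bar>mean_reciprocal p h\<bar>)"
    using gen mean_reciprocal_bounds[OF assms(1,2)] by (simp add: sums_iff)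
  from off_critical_ratio[OF assms this] show ?thesis
    using gen rp by (simp add: sums_iff mult_ac)
qed

text \<open>Since \<open>K \<le> H\<close> and \<open>H\<close> has geometric tails, the mean of \<open>K\<close> converges; this is what makes \<open>m\<close> the relaxation scale off criticality.\<close>

lemma off_critical_mean_convergent:
  assumes "0 < p" "p < 1" "p \<noteq> 1/2"
  shows "convergent (\<lambda>n. spectral_sum p n real / spectral_sum p n (\<lambda>_. 1))"
proof -
  have r: "0 < meet_ratio p" "meet_ratio p < 1" using meet_ratio_bounds[of p] assms by auto
  have bound: "\<bar>binomial_sum p h real\<bar> \<le> real h" for h
  proof -
    have "0 \<le> binomial_sum p h real"
      using binomial_sum_mono[OF assms(1,2), of h "\<lambda>_. 0" real] by (simp add: binomial_sum_def)
    moreover have "binomial_sum p h real \<le> binomial_sum p h (\<lambda>_. real h * 1)"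
      by (intro binomial_sum_mono assms) auto
    moreover have "binomial_sum p h (\<lambda>_. real h * 1) = real h * binomial_sum p h (\<lambda>_. 1)"
      unfolding binomial_sum_def by (simp add: sum_distrib_left mult_ac)
    moreover have "real h * binomial_sum p h (\<lambda>_. 1) \<le> real h * 1"
      using assms by (intro mult_left_mono) (auto simp: binomial_sum_const)
    ultimately show ?thesis by simp
  qed
  have "summable (\<lambda>h. meet_ratio p ^ h * \<bar>binomial_sum p h real\<bar>)"
  proof (rule summable_comparison_test')
    show "summable (\<lambda>h. real (Suc h) * meet_ratio p ^ h)"
      using geometric_deriv_sums[of "meet_ratio p"] r by (simp add: sums_iff)
    show "norm (meet_ratio p ^ h * \<bar>binomial_sum p h real\<bar>) \<le> real (Suc h) * meet_ratio p ^ h" if "h \<ge> 0" for h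
    proof -
      have "\<bar>binomial_sum p h real\<bar> \<le> real (Suc h)" using bound[of h] by simp
      then have "meet_ratio p ^ h * \<bar>binomial_sum p h real\<bar> \<le> meet_ratio p ^ h * real (Suc h)"
        using r by (intro mult_left_mono) auto
      then show ?thesis using r by (simp add: abs_mult mult.commute)
    qed
  qed
  from off_critical_ratio[OF assms this] show ?thesis by (rule convergentI)
qed

section \<open>Limits at criticality\<close>

lemma meet_sum_critical: "meet_sum (1/2) n = ((real n + 2)\<^sup>2 - 2) / 2"
  by (simp add: meet_sum_def branch_sum_def power2_eq_square algebra_simps)

lemma meet_sum_critical_bounds:
  assumes "h \<le> n"
  shows "0 \<le> meet_sum (1/2) (n - h)" "meet_sum (1/2) (n - h) \<le> (real n + 2)\<^sup>2 / 2"
proof -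
  have "(real (n - h) + 2)\<^sup>2 \<le> (real n + 2)\<^sup>2" by (intro power_mono) auto
  moreover have "(x - 2) / 2 \<le> y / 2" if "x \<le> y" for x y :: real using that by simp
  ultimately show "meet_sum (1/2) (n - h) \<le> (real n + 2)\<^sup>2 / 2" unfolding meet_sum_critical by blast
qed (simp add: less_imp_le meet_sum_pos)

lemma spectral_sum_critical:
  "spectral_sum (1/2) n g = (\<Sum>h\<le>n. meet_sum (1/2) (n - h) * binomial_sum (1/2) h g)"
  by (simp add: spectral_sum_def tree_sum_def)

lemma sum_half_powers_le: "(\<Sum>h\<le>n. (1/2) ^ h :: real) \<le> 2"
  using geometric_sum[of "1/2 :: real" "Suc n"] by (simp add: lessThan_Suc_atMost)

text \<open>The sum of the weights is an explicit cubic polynomial in \<open>n\<close>, and the correction for \<open>K = 0\<close> is only quadratic.\<close>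

lemma critical_variance: "(\<lambda>n. spectral_sum (1/2) n (\<lambda>_. 1) / real n ^ 3) \<longlonglongrightarrow> 1 / 6"
proof -
  define Q where "Q n = ((real n + 2) * (real n + 3) * (2 * real n + 5) / 6 - 1) / 2 - (real n + 1)" for n :: nat
  have total: "(\<Sum>h\<le>n. meet_sum (1/2) (n - h)) = Q n" for n
  proof -
    have "(\<Sum>h\<le>n. meet_sum (1/2) (n - h)) = (\<Sum>h\<le>n. meet_sum (1/2) h)"
      using sum.nat_diff_reindex[of "meet_sum (1/2)" "Suc n"] by (simp add: lessThan_Suc_atMost)
    also have "\<dots> = Q n"
      by (induction n) (simp_all add: meet_sum_critical Q_def power2_eq_square field_simps)
    finally show ?thesis .
  qed
  have split: "spectral_sum (1/2) n (\<lambda>_. 1) = Q n - (\<Sum>h\<le>n. meet_sum (1/2) (n - h) * (1/2) ^ h)" for n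
    by (simp add: spectral_sum_critical binomial_sum_const total[symmetric] sum_subtractf[symmetric] algebra_simps)
  have low: "0 \<le> (\<Sum>h\<le>n. meet_sum (1/2) (n - h) * (1/2) ^ h)" for n
    by (intro sum_nonneg mult_nonneg_nonneg meet_sum_critical_bounds) auto
  have up: "(\<Sum>h\<le>n. meet_sum (1/2) (n - h) * (1/2) ^ h) \<le> (real n + 2)\<^sup>2" for n
  proof -
    have "(\<Sum>h\<le>n. meet_sum (1/2) (n - h) * (1/2) ^ h) \<le> (\<Sum>h\<le>n. (real n + 2)\<^sup>2 / 2 * (1/2) ^ h)"
      by (intro sum_mono mult_right_mono meet_sum_critical_bounds) auto
    also have "\<dots> = (real n + 2)\<^sup>2 / 2 * (\<Sum>h\<le>n. (1/2) ^ h)" by (rule sum_distrib_left[symmetric])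
    also have "\<dots> \<le> (real n + 2)\<^sup>2 / 2 * 2" by (intro mult_left_mono sum_half_powers_le) auto
    finally show ?thesis by simp
  qed
  show ?thesis
  proof (rule tendsto_sandwich)
    show "(\<lambda>n. (Q n - (real n + 2)\<^sup>2) / real n ^ 3) \<longlonglongrightarrow> 1 / 6" unfolding Q_def by real_asymp
    show "(\<lambda>n. Q n / real n ^ 3) \<longlonglongrightarrow> 1 / 6" unfolding Q_def by real_asymp
  qed (use low up in \<open>auto simp: split intro!: always_eventually divide_right_mono\<close>)
qed

text \<open>A binomial variable with parameters \<open>h\<close> and \<open>1/2\<close> concentrates at \<open>h/2\<close>. The recursion for its mean reciprocal halves the deviation from \<open>2 / (h + 1)\<close> up to a summable error, so the deviations are summable. Against the bounded weights \<open>meet_sum / n^2\<close> they are negligible next to a harmonic sum.\<close>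

lemma critical_mean_reciprocal_error:
  "(\<Sum>h\<le>n. \<bar>mean_reciprocal (1/2) h - 2 / (real h + 1)\<bar>) \<le> 10"
proof -
  define e where "e h = \<bar>mean_reciprocal (1/2) h - 2 / (real h + 1)\<bar>" for h
  \<comment> \<open>The error terms telescope, respectively form a geometric series; their partial sums give the explicit bound below.\<close>
  have step: "e (Suc h) \<le> e h / 2 + (2 / (real h + 1) - 2 / (real h + 2)) + (1/2) ^ Suc h" for h
  proof -
    have "mean_reciprocal (1/2) (Suc h) - 2 / (real h + 2)
        = (mean_reciprocal (1/2) h - 2 / (real h + 1)) / 2 + (2 / (real h + 1) - 2 / (real h + 2))
          - (1/2) ^ Suc h / (real h + 1)"
      proof -
      have split: "1/2 * I + (1 - w) / x - c = (I - 2 / x) / 2 + (2 / x - c) - w / x" for I w x c :: real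
        by (cases "x = 0") (simp_all add: field_simps)
      have "real (Suc h) = real h + 1" by simp
      then show ?thesis unfolding mean_reciprocal_Suc by (simp only: split)
    qed
    moreover have "2 / (real h + 2) \<le> 2 / (real h + 1)" by (intro divide_left_mono) auto
    moreover have "(1/2 :: real) ^ Suc h / (real h + 1) \<le> (1/2) ^ Suc h"
      using divide_left_mono[of 1 "real h + 1" "(1/2::real) ^ Suc h"] by simp
    moreover have "0 \<le> (1/2 :: real) ^ Suc h / (real h + 1)" by simp
    moreover have "e (Suc h) = \<bar>mean_reciprocal (1/2) (Suc h) - 2 / (real h + 2)\<bar>"
      by (simp add: e_def add.commute)
    moreover have "\<bar>x\<bar> \<le> \<bar>y\<bar> / 2 + d + w"
      if "x = y / 2 + d - v" "0 \<le> v" "v \<le> w" "0 \<le> d" for x y d v w :: real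
      using that by linarith
    ultimately show ?thesis unfolding e_def by (metis diff_ge_0_iff_ge)
  qed
  have "(\<Sum>h\<le>n. e h) + e n \<le> 10 - 4 / (real n + 1) - 2 * (1/2) ^ n"
  proof (induction n)
    case 0
    then show ?case by (simp add: e_def binomial_sum_0)
  next
    case (Suc n)
    have "(\<Sum>h\<le>Suc n. e h) + e (Suc n) = (\<Sum>h\<le>n. e h) + 2 * e (Suc n)" by simp
    with Suc step[of n] show ?case by (simp add: add.commute)
  qed
  moreover have "0 \<le> e n" by (simp add: e_def)
  moreover have "0 \<le> 4 / (real n + 1)" "0 \<le> 2 * (1/2 :: real) ^ n" by auto
  ultimately show ?thesis unfolding e_def by linarith
qed

text \<open>Replacing the mean reciprocal by \<open>2 / (h + 1)\<close> and \<open>meet_sum\<close> by \<open>(n + 2)^2 / 2\<close> leaves a harmonic sum. Both replacements cost only \<open>O(n^2)\<close>, hence a factor \<open>ln n\<close> less than the main term.\<close>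

lemma critical_reciprocal_sum:
  "\<bar>spectral_sum (1/2) n (\<lambda>k. 1 / real k) - (real n + 2)\<^sup>2 * harm (Suc n)\<bar> \<le> 7 * (real n + 2)\<^sup>2"
proof -
  let ?I = "mean_reciprocal (1/2)" and ?D = "\<lambda>h. meet_sum (1/2) (n - h)"
  have harm: "harm (Suc n) = (\<Sum>h\<le>n. 1 / (real h + 1))"
    by (simp add: harm_altdef lessThan_Suc_atMost field_simps)
  have split: "(\<Sum>h\<le>n. D h * I h) - c * (\<Sum>h\<le>n. 1 / (real h + 1))
      = (\<Sum>h\<le>n. D h * (I h - 2 / (real h + 1))) + (\<Sum>h\<le>n. (2 * D h - c) / (real h + 1))"
    for D I :: "nat \<Rightarrow> real" and c
    unfolding sum_distrib_left sum.distrib[symmetric] sum_subtractf[symmetric]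
    by (intro sum.cong refl) (simp add: right_diff_distrib diff_divide_distrib)
  have "\<bar>\<Sum>h\<le>n. ?D h * (?I h - 2 / (real h + 1))\<bar> \<le> (\<Sum>h\<le>n. (real n + 2)\<^sup>2 / 2 * \<bar>?I h - 2 / (real h + 1)\<bar>)"
  proof (intro order_trans[OF sum_abs] sum_mono)
    fix h assume "h \<in> {..n}"
    then have "\<bar>?D h\<bar> \<le> (real n + 2)\<^sup>2 / 2" using meet_sum_critical_bounds[of h n] by simp
    then show "\<bar>?D h * (?I h - 2 / (real h + 1))\<bar> \<le> (real n + 2)\<^sup>2 / 2 * \<bar>?I h - 2 / (real h + 1)\<bar>"
      unfolding abs_mult by (rule mult_right_mono) simp
  qed
  also have "\<dots> \<le> (real n + 2)\<^sup>2 / 2 * 10"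
    unfolding sum_distrib_left[symmetric] by (intro mult_left_mono critical_mean_reciprocal_error) simp
  finally have first: "\<bar>\<Sum>h\<le>n. ?D h * (?I h - 2 / (real h + 1))\<bar> \<le> (real n + 2)\<^sup>2 / 2 * 10" .
  have "\<bar>\<Sum>h\<le>n. (2 * ?D h - (real n + 2)\<^sup>2) / (real h + 1)\<bar> \<le> (\<Sum>h\<le>n. 2 * (real n + 2))"
  proof (intro order_trans[OF sum_abs] sum_mono)
    fix h assume "h \<in> {..n}"
    then have h: "h \<le> n" by simp
    have eq: "2 * ?D h - (real n + 2)\<^sup>2 = - (real h * (2 * (real n + 2) - real h) + 2)"
    proof -
      have "2 * ?D h = (real n - real h + 2)\<^sup>2 - 2" using h by (simp add: meet_sum_critical of_nat_diff)
      then show ?thesis by (simp add: power2_eq_square algebra_simps)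
    qed
    have "real h * (2 * (real n + 2) - real h) \<le> real h * (2 * (real n + 2))" by (intro mult_left_mono) auto
    moreover have "0 \<le> real h * (2 * (real n + 2) - real h)" using h by (intro mult_nonneg_nonneg) auto
    ultimately have "\<bar>2 * ?D h - (real n + 2)\<^sup>2\<bar> \<le> real h * (2 * (real n + 2)) + 2" unfolding eq by linarith
    also have "\<dots> \<le> 2 * (real n + 2) * (real h + 1)" by (simp add: algebra_simps)
    finally show "\<bar>(2 * ?D h - (real n + 2)\<^sup>2) / (real h + 1)\<bar> \<le> 2 * (real n + 2)"
      by (simp add: abs_divide pos_divide_le_eq)
  qed
  also have "\<dots> \<le> 2 * (real n + 2)\<^sup>2" by (simp add: power2_eq_square algebra_simps)
  finally have second: "\<bar>\<Sum>h\<le>n. (2 * ?D h - (real n + 2)\<^sup>2) / (real h + 1)\<bar> \<le> 2 * (real n + 2)\<^sup>2" .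
  have bound: "\<bar>x + y\<bar> \<le> 7 * c" if "\<bar>x\<bar> \<le> c / 2 * 10" "\<bar>y\<bar> \<le> 2 * c" for x y c :: real
    using that by linarith
  show ?thesis
    unfolding spectral_sum_critical harm split[of ?D ?I "(real n + 2)\<^sup>2"] by (rule bound[OF first second])
qed

lemma critical_mean_reciprocal:
  "(\<lambda>n. (spectral_sum (1/2) n (\<lambda>k. 1 / real k) / spectral_sum (1/2) n (\<lambda>_. 1)) / (ln (real n) / real n)) \<longlonglongrightarrow> 6"
proof -
  define R where "R n = spectral_sum (1/2) n (\<lambda>k. 1 / real k)" for n
  define V where "V n = spectral_sum (1/2) n (\<lambda>_. 1)" for n
  have harm: "(\<lambda>n. harm (Suc n) / ln (real n)) \<longlonglongrightarrow> 1"
  proof -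
    have "filterlim (\<lambda>n. ln (real n)) at_infinity sequentially" by real_asymp
    then have "(\<lambda>n. (harm n - ln (real n)) / ln (real n)) \<longlonglongrightarrow> 0"
      by (rule tendsto_divide_0[OF euler_mascheroni_LIMSEQ])
    moreover have "(\<lambda>n. 1 + inverse (real (Suc n)) / ln (real n)) \<longlonglongrightarrow> 1" by real_asymp
    ultimately have "(\<lambda>n. (harm n - ln (real n)) / ln (real n) + (1 + inverse (real (Suc n)) / ln (real n))) \<longlonglongrightarrow> 0 + 1"
      by (rule tendsto_add)
    moreover have "eventually (\<lambda>n. (harm n - ln (real n)) / ln (real n) + (1 + inverse (real (Suc n)) / ln (real n))
        = harm (Suc n) / ln (real n)) sequentially"
      using eventually_gt_at_top[of 1] 
    proof eventually_elim
      case (elim n)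
      then have "ln (real n) \<noteq> 0" by simp
      then show ?case unfolding harm_Suc add_divide_distrib diff_divide_distrib by simp
    qed
    ultimately show ?thesis by (simp add: Lim_transform_eventually)
  qed
  have diff: "(\<lambda>n. R n / ((real n + 2)\<^sup>2 * ln (real n)) - harm (Suc n) / ln (real n)) \<longlonglongrightarrow> 0"
  proof (rule Lim_null_comparison)
    show "(\<lambda>n. 7 / ln (real n)) \<longlonglongrightarrow> 0" by real_asymp
    show "eventually (\<lambda>n. norm (R n / ((real n + 2)\<^sup>2 * ln (real n)) - harm (Suc n) / ln (real n)) \<le> 7 / ln (real n)) sequentially"
      using eventually_gt_at_top[of 1]
    proof eventually_elim
      case (elim n)
      then have l: "ln (real n) > 0" by simp
      have "R n / ((real n + 2)\<^sup>2 * ln (real n)) - harm (Suc n) / ln (real n)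
          = (R n - (real n + 2)\<^sup>2 * harm (Suc n)) / ((real n + 2)\<^sup>2 * ln (real n))"
        by (simp add: diff_divide_distrib)
      also have "norm \<dots> = \<bar>R n - (real n + 2)\<^sup>2 * harm (Suc n)\<bar> / ((real n + 2)\<^sup>2 * ln (real n))"
        using l by (simp add: abs_mult)
      also have "\<dots> \<le> 7 * (real n + 2)\<^sup>2 / ((real n + 2)\<^sup>2 * ln (real n))"
        unfolding R_def using critical_reciprocal_sum[of n] l by (intro divide_right_mono) simp_all
      also have "\<dots> = 7 / ln (real n)" by simp
      finally show ?case .
    qed
  qed
  have numer: "(\<lambda>n. R n / ((real n + 2)\<^sup>2 * ln (real n))) \<longlonglongrightarrow> 1"
    using tendsto_add[OF diff harm] by simp
  have shift: "(\<lambda>n. (real n + 2)\<^sup>2 / (real n)\<^sup>2) \<longlonglongrightarrow> 1" by real_asymp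
  have denom: "(\<lambda>n. V n / real n ^ 3) \<longlonglongrightarrow> 1 / 6" unfolding V_def by (rule critical_variance)
  have "(\<lambda>n. R n / ((real n + 2)\<^sup>2 * ln (real n)) * ((real n + 2)\<^sup>2 / (real n)\<^sup>2) / (V n / real n ^ 3)) \<longlonglongrightarrow> 6"
    using tendsto_divide[OF tendsto_mult[OF numer shift] denom] by simp
  moreover have "eventually (\<lambda>n. R n / ((real n + 2)\<^sup>2 * ln (real n)) * ((real n + 2)\<^sup>2 / (real n)\<^sup>2) / (V n / real n ^ 3)
      = (R n / V n) / (ln (real n) / real n)) sequentially"
    using eventually_gt_at_top[of 1]
  proof eventually_elim
    case (elim n)
    have cancel: "x / (c * l) * (c / k\<^sup>2) / (v / k ^ 3) = (x / v) / (l / k)" if "c \<noteq> 0" "k \<noteq> 0" for x c l k v :: real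
      using that by (cases "v = 0"; cases "l = 0") (simp_all add: field_simps power2_eq_square power3_eq_cube)
    have "(real n + 2)\<^sup>2 \<noteq> 0" by simp
    then show ?case by (rule cancel) (use elim in simp)
  qed
  ultimately show ?thesis unfolding R_def V_def by (auto dest: Lim_transform_eventually)
qed

text \<open>Bound every weight by the largest one and sum the geometric series of \<open>((1 + x) / 2) ^ h\<close>. Relative to the variance, of order \<open>n ^ 3\<close>, the result is small as soon as \<open>n * (1 - x)\<close> is large.\<close>

lemma spectral_sum_critical_power_le:
  assumes "0 \<le> x" "x < 1"
  shows "spectral_sum (1/2) n (\<lambda>k. x ^ k) \<le> (real n + 2)\<^sup>2 / (1 - x)"
proof -
  have "spectral_sum (1/2) n (\<lambda>k. x ^ k) \<le> (\<Sum>h\<le>n. (real n + 2)\<^sup>2 / 2 * ((1 + x) / 2) ^ h)"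
    unfolding spectral_sum_critical
  proof (intro sum_mono mult_mono)
    fix h assume "h \<in> {..n}"
    then show "meet_sum (1/2) (n - h) \<le> (real n + 2)\<^sup>2 / 2" by (intro meet_sum_critical_bounds) auto
    show "binomial_sum (1/2) h (\<lambda>k. x ^ k) \<le> ((1 + x) / 2) ^ h"
      by (simp add: binomial_sum_power add_divide_distrib)
    show "0 \<le> binomial_sum (1/2) h (\<lambda>k. x ^ k)"
      using assms by (auto simp: binomial_sum_def intro!: sum_nonneg)
  qed auto
  also have "\<dots> = (real n + 2)\<^sup>2 / 2 * (\<Sum>h\<le>n. ((1 + x) / 2) ^ h)" by (rule sum_distrib_left[symmetric])
  also have "(\<Sum>h\<le>n. ((1 + x) / 2) ^ h) \<le> (\<Sum>h. ((1 + x) / 2) ^ h)"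
    using assms by (intro sum_le_suminf) auto
  also have "(\<Sum>h. ((1 + x) / 2) ^ h) = 2 / (1 - x)"
    using assms by (subst suminf_geometric) (auto simp: field_simps)
  finally show ?thesis by (simp add: mult_left_mono)
qed

section \<open>Limits of the autocorrelations\<close>

text \<open>Bernoulli's inequality for each eigenvalue: the correlation lost by time \<open>s\<close> is at most \<open>s/m\<close> times the spectral mean of \<open>k\<close>.\<close>

lemma autocorr_one_minus_le:
  assumes "dynamical_percolation p (tree_edges n) M Z" "n \<ge> 1" "0 < p" "p < 1"
  shows "0 \<le> 1 - autocorr M Z (root_cluster_size n) s"
    and "1 - autocorr M Z (root_cluster_size n) s
      \<le> real s / real (card (tree_edges n)) * (spectral_sum p n real / spectral_sum p n (\<lambda>_. 1))"
proof -
  define m where "m = real (card (tree_edges n))"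
  define R where "R = spectral_sum p n (\<lambda>_. 1)"
  have m: "real n \<le> m" "0 < m" using depth_le_card_tree_edges[of n] assms(2) by (auto simp: m_def)
  have R: "R > 0" unfolding R_def using assms by (intro spectral_sum_1_pos)
  have "1 - autocorr M Z (root_cluster_size n) s = (R - spectral_sum p n (\<lambda>k. (1 - real k / m) ^ s)) / R"
    using R by (simp add: root_cluster_autocorr[OF assms(1,2)] R_def[symmetric] m_def[symmetric] diff_divide_distrib)
  also have "R - spectral_sum p n (\<lambda>k. (1 - real k / m) ^ s) = spectral_sum p n (\<lambda>k. 1 - (1 - real k / m) ^ s)"
    by (simp only: spectral_sum_linear R_def)
  finally have eq: "1 - autocorr M Z (root_cluster_size n) s = spectral_sum p n (\<lambda>k. 1 - (1 - real k / m) ^ s) / R" .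
  have k: "0 \<le> 1 - real k / m" "1 - real k / m \<le> 1" if "1 \<le> k" "k \<le> n" for k
    using that m by (auto simp: field_simps)
  have "spectral_sum p n (\<lambda>k. 0 * 1) \<le> spectral_sum p n (\<lambda>k. 1 - (1 - real k / m) ^ s)"
    using k by (intro spectral_sum_mono assms) (simp add: power_le_one)
  then show "0 \<le> 1 - autocorr M Z (root_cluster_size n) s"
    unfolding eq spectral_sum_linear using R by simp
  have "spectral_sum p n (\<lambda>k. 1 - (1 - real k / m) ^ s) \<le> spectral_sum p n (\<lambda>k. real s / m * real k)"
  proof (intro spectral_sum_mono assms)
    fix k assume "1 \<le> k" "k \<le> n"
    then have "1 + real s * (- (real k / m)) \<le> (1 + - (real k / m)) ^ s"
      using k[of k] by (intro Bernoulli_inequality) linarith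
    then show "1 - (1 - real k / m) ^ s \<le> real s / m * real k" by (simp add: mult.commute)
  qed
  also have "\<dots> = real s / m * spectral_sum p n real" by (rule spectral_sum_linear)
  finally have "spectral_sum p n (\<lambda>k. 1 - (1 - real k / m) ^ s) / R \<le> real s / m * spectral_sum p n real / R"
    using R by (intro divide_right_mono) auto
  then show "1 - autocorr M Z (root_cluster_size n) s
      \<le> real s / real (card (tree_edges n)) * (spectral_sum p n real / spectral_sum p n (\<lambda>_. 1))"
    unfolding eq by (simp only: R_def[symmetric] m_def[symmetric] times_divide_eq_right)
qed

lemma autocorr_tendsto_1:
  assumes "0 < p" "p < 1" "\<And>n. n \<ge> 1 \<Longrightarrow> dynamical_percolation p (tree_edges n) (M n) (Z n)"
    and lim: "(\<lambda>n. real (s n) / real (card (tree_edges n)) * (spectral_sum p n real / spectral_sum p n (\<lambda>_. 1))) \<longlonglongrightarrow> 0"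
  shows "(\<lambda>n. autocorr (M n) (Z n) (root_cluster_size n) (s n)) \<longlonglongrightarrow> 1"
proof -
  have "(\<lambda>n. 1 - autocorr (M n) (Z n) (root_cluster_size n) (s n)) \<longlonglongrightarrow> 0"
  proof (rule tendsto_sandwich[OF _ _ tendsto_const lim])
    show "\<forall>\<^sub>F n in sequentially. 0 \<le> 1 - autocorr (M n) (Z n) (root_cluster_size n) (s n)"
      using eventually_ge_at_top[of 1] by eventually_elim (use assms in \<open>intro autocorr_one_minus_le\<close>)
    show "\<forall>\<^sub>F n in sequentially. 1 - autocorr (M n) (Z n) (root_cluster_size n) (s n)
        \<le> real (s n) / real (card (tree_edges n)) * (spectral_sum p n real / spectral_sum p n (\<lambda>_. 1))"
      using eventually_ge_at_top[of 1] by eventually_elim (use assms in \<open>intro autocorr_one_minus_le\<close>)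
  qed
  from tendsto_diff[OF tendsto_const[of 1] this] show ?thesis by simp
qed

lemma one_minus_inverse_power_le:
  assumes "1 \<le> (m::real)"
  shows "0 \<le> (1 - 1 / m) ^ s" "(1 - 1 / m) ^ s \<le> m / (m + real s)"
proof -
  show nonneg: "0 \<le> (1 - 1 / m) ^ s" using assms by simp
  have "(1 - 1 / m) * (1 + 1 / m) \<le> 1" using assms by (simp add: field_simps)
  then have "((1 - 1 / m) * (1 + 1 / m)) ^ s \<le> 1" using assms by (intro power_le_one) auto
  then have le1: "(1 - 1 / m) ^ s * (1 + 1 / m) ^ s \<le> 1" by (simp only: power_mult_distrib)
  have "1 + real s * (1 / m) \<le> (1 + 1 / m) ^ s" using assms by (intro Bernoulli_inequality) (simp add: order_trans[of _ 0])
  then have "(1 - 1 / m) ^ s * (1 + real s * (1 / m)) \<le> (1 - 1 / m) ^ s * (1 + 1 / m) ^ s"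
    using nonneg by (intro mult_left_mono)
  with le1 have "(1 - 1 / m) ^ s * (1 + real s * (1 / m)) \<le> 1" by linarith
  moreover have "1 + real s * (1 / m) = (m + real s) / m" using assms by (simp add: field_simps)
  ultimately show "(1 - 1 / m) ^ s \<le> m / (m + real s)" using assms by (simp add: field_simps)
qed

text \<open>By Bernoulli's inequality \<open>1 - k/m \<le> (1 - 1/m) ^ k\<close>, so each eigenvalue is compared with a power of the largest nontrivial one, \<open>1 - 1/m\<close>.\<close>

lemma autocorr_le_power_mean:
  fixes s :: nat
  assumes "dynamical_percolation p (tree_edges n) M Z" "n \<ge> 1" "0 < p" "p < 1"
  defines "x \<equiv> (1 - 1 / real (card (tree_edges n))) ^ s"
  shows "0 \<le> autocorr M Z (root_cluster_size n) s"
    and "autocorr M Z (root_cluster_size n) s \<le> spectral_sum p n (\<lambda>k. x ^ k) / spectral_sum p n (\<lambda>_. 1)"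
    and "autocorr M Z (root_cluster_size n) s \<le> x"
proof -
  define m where "m = real (card (tree_edges n))"
  define R where "R = spectral_sum p n (\<lambda>_. 1)"
  have m: "real n \<le> m" "1 \<le> m" using depth_le_card_tree_edges[of n] assms(2) by (auto simp: m_def)
  have R: "R > 0" unfolding R_def using assms by (intro spectral_sum_1_pos)
  have eq: "autocorr M Z (root_cluster_size n) s = spectral_sum p n (\<lambda>k. (1 - real k / m) ^ s) / R"
    by (simp add: root_cluster_autocorr[OF assms(1,2)] R_def m_def)
  have k: "0 \<le> 1 - real k / m" if "1 \<le> k" "k \<le> n" for k using that m by (auto simp: field_simps)
  have x: "x = (1 - 1 / m) ^ s" "0 \<le> x" "x \<le> 1"
    using m by (auto simp: x_def m_def[symmetric] power_le_one)
  have "spectral_sum p n (\<lambda>k. 0 * 1) \<le> spectral_sum p n (\<lambda>k. (1 - real k / m) ^ s)"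
    using k by (intro spectral_sum_mono assms) simp
  then show "0 \<le> autocorr M Z (root_cluster_size n) s"
    unfolding eq spectral_sum_linear using R by simp
  have "spectral_sum p n (\<lambda>k. (1 - real k / m) ^ s) \<le> spectral_sum p n (\<lambda>k. x ^ k)"
  proof (intro spectral_sum_mono assms)
    fix k assume kn: "1 \<le> k" "k \<le> n"
    have "1 + real k * (- (1 / m)) \<le> (1 + - (1 / m)) ^ k" using m by (intro Bernoulli_inequality) (simp add: field_simps)
    then have "1 - real k / m \<le> (1 - 1 / m) ^ k" by simp
    then have "(1 - real k / m) ^ s \<le> ((1 - 1 / m) ^ k) ^ s" using k[OF kn] by (intro power_mono)
    also have "\<dots> = x ^ k" by (simp only: x(1) power_mult[symmetric] mult.commute)
    finally show "(1 - real k / m) ^ s \<le> x ^ k" .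
  qed
  then show le: "autocorr M Z (root_cluster_size n) s \<le> spectral_sum p n (\<lambda>k. x ^ k) / spectral_sum p n (\<lambda>_. 1)"
    unfolding eq R_def[symmetric] using R by (simp add: divide_right_mono)
  have "spectral_sum p n (\<lambda>k. x ^ k) \<le> spectral_sum p n (\<lambda>k. x * 1)"
  proof (intro spectral_sum_mono assms)
    fix k :: nat assume "1 \<le> k"
    then show "x ^ k \<le> x * 1" using power_decreasing[of 1 k x] x by simp
  qed
  also have "\<dots> = x * R" unfolding spectral_sum_linear R_def ..
  finally have "spectral_sum p n (\<lambda>k. x ^ k) / R \<le> x" using R by (simp add: pos_divide_le_eq)
  with le show "autocorr M Z (root_cluster_size n) s \<le> x" by (simp add: R_def)
qed

text \<open>The mean of \<open>K\<close> converges, which gives the limit \<open>1\<close>; \<open>K \<ge> 1\<close> alone gives the limit \<open>0\<close>.\<close>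

lemma off_critical_autocorr_limits:
  assumes p: "0 < p" "p < 1" "p \<noteq> 1/2"
    and Z: "\<And>n. n \<ge> 1 \<Longrightarrow> dynamical_percolation p (tree_edges n) (M n) (Z n)"
    and s: "\<And>n. n \<ge> 1 \<Longrightarrow> s n > 0"
  shows "(\<lambda>n. real (s n)) \<in> o(\<lambda>n. real (card (tree_edges n))) \<Longrightarrow>
      (\<lambda>n. autocorr (M n) (Z n) (root_cluster_size n) (s n)) \<longlonglongrightarrow> 1" (is "?A \<Longrightarrow> _")
    and "(\<lambda>n. real (card (tree_edges n))) \<in> o(\<lambda>n. real (s n)) \<Longrightarrow>
      (\<lambda>n. autocorr (M n) (Z n) (root_cluster_size n) (s n)) \<longlonglongrightarrow> 0" (is "?B \<Longrightarrow> _")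
proof -
  assume ?A
  obtain c where "(\<lambda>n. spectral_sum p n real / spectral_sum p n (\<lambda>_. 1)) \<longlonglongrightarrow> c"
    using off_critical_mean_convergent[OF p] by (auto simp: convergent_def)
  from tendsto_mult[OF smalloD_tendsto[OF \<open>?A\<close>] this]
  show "(\<lambda>n. autocorr (M n) (Z n) (root_cluster_size n) (s n)) \<longlonglongrightarrow> 1"
    by (intro autocorr_tendsto_1[OF p(1,2) Z]) simp_all
next
  assume ?B
  show "(\<lambda>n. autocorr (M n) (Z n) (root_cluster_size n) (s n)) \<longlonglongrightarrow> 0"
  proof (rule tendsto_sandwich[OF _ _ tendsto_const smalloD_tendsto[OF \<open>?B\<close>]])
    show "\<forall>\<^sub>F n in sequentially. 0 \<le> autocorr (M n) (Z n) (root_cluster_size n) (s n)"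
      using eventually_ge_at_top[of 1] by eventually_elim (use Z p in \<open>intro autocorr_le_power_mean\<close>)
    show "\<forall>\<^sub>F n in sequentially. autocorr (M n) (Z n) (root_cluster_size n) (s n) \<le> real (card (tree_edges n)) / real (s n)"
      using eventually_ge_at_top[of 1]
    proof eventually_elim
      case (elim n)
      define m where "m = real (card (tree_edges n))"
      have m: "1 \<le> m" using depth_le_card_tree_edges[of n] elim by (simp add: m_def)
      have "autocorr (M n) (Z n) (root_cluster_size n) (s n) \<le> (1 - 1 / m) ^ s n"
        unfolding m_def by (rule autocorr_le_power_mean(3)[OF Z[OF elim] elim p(1,2)])
      also have "\<dots> \<le> m / (m + real (s n))" by (rule one_minus_inverse_power_le[OF m])
      also have "\<dots> \<le> m / real (s n)" using m s[OF elim] by (intro divide_left_mono) auto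
      finally show ?case by (simp add: m_def)
    qed
  qed
qed

text \<open>For the limit \<open>1\<close> the bound \<open>K \<le> n\<close> suffices. For the limit \<open>0\<close>, \<open>x = (1 - 1/m) ^ s\<close> satisfies \<open>1 / (1 - x) \<le> 1 + m/s\<close>, and the autocorrelation is of order at most \<open>(1 + m/s) / n\<close>.\<close>

lemma critical_autocorr_limits:
  assumes Z: "\<And>n. n \<ge> 1 \<Longrightarrow> dynamical_percolation (1/2) (tree_edges n) (M n) (Z n)"
    and s: "\<And>n. n \<ge> 1 \<Longrightarrow> s n > 0"
  shows "(\<lambda>n. real (s n)) \<in> o(\<lambda>n. real (card (tree_edges n)) / real n) \<Longrightarrow>
      (\<lambda>n. autocorr (M n) (Z n) (root_cluster_size n) (s n)) \<longlonglongrightarrow> 1" (is "?A \<Longrightarrow> _")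
    and "(\<lambda>n. real (card (tree_edges n)) / real n) \<in> o(\<lambda>n. real (s n)) \<Longrightarrow>
      (\<lambda>n. autocorr (M n) (Z n) (root_cluster_size n) (s n)) \<longlonglongrightarrow> 0" (is "?B \<Longrightarrow> _")
proof -
  define R where "R n = spectral_sum (1/2) n (\<lambda>_. 1)" for n
  have R: "R n > 0" if "n \<ge> 1" for n unfolding R_def using that by (intro spectral_sum_1_pos) auto
  { assume ?A
    show "(\<lambda>n. autocorr (M n) (Z n) (root_cluster_size n) (s n)) \<longlonglongrightarrow> 1"
    proof (rule autocorr_tendsto_1[OF _ _ Z])
      show "(\<lambda>n. real (s n) / real (card (tree_edges n)) * (spectral_sum (1/2) n real / spectral_sum (1/2) n (\<lambda>_. 1))) \<longlonglongrightarrow> 0"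
      proof (rule tendsto_sandwich[OF _ _ tendsto_const smalloD_tendsto[OF \<open>?A\<close>]])
        have bounds: "0 \<le> spectral_sum (1/2) n real / R n \<and> spectral_sum (1/2) n real / R n \<le> real n" if "n \<ge> 1" for n
        proof -
          have "spectral_sum (1/2) n (\<lambda>k. 0 * 1) \<le> spectral_sum (1/2) n real" by (intro spectral_sum_mono) auto
          moreover have "spectral_sum (1/2) n real \<le> spectral_sum (1/2) n (\<lambda>k. real n * 1)" by (intro spectral_sum_mono) auto
          ultimately show ?thesis
            unfolding spectral_sum_linear R_def[symmetric] using R[OF that] by (simp add: pos_divide_le_eq)
        qed
        show "\<forall>\<^sub>F n in sequentially. 0 \<le> real (s n) / real (card (tree_edges n)) * (spectral_sum (1/2) n real / spectral_sum (1/2) n (\<lambda>_. 1))"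
          using eventually_ge_at_top[of 1]
        proof eventually_elim
          case (elim n)
          show ?case by (rule mult_nonneg_nonneg) (use bounds[OF elim] in \<open>simp_all add: R_def\<close>)
        qed
        show "\<forall>\<^sub>F n in sequentially. real (s n) / real (card (tree_edges n)) * (spectral_sum (1/2) n real / spectral_sum (1/2) n (\<lambda>_. 1))
            \<le> real (s n) / (real (card (tree_edges n)) / real n)"
          using eventually_ge_at_top[of 1]
        proof eventually_elim
          case (elim n)
          have "real (s n) / real (card (tree_edges n)) * (spectral_sum (1/2) n real / R n) \<le> real (s n) / real (card (tree_edges n)) * real n"
            using bounds[OF elim] by (intro mult_left_mono) auto
          then show ?case by (simp add: R_def)
        qed
      qed
    qed auto
  next
    assume ?B
    define x where "x n = (1 - 1 / real (card (tree_edges n))) ^ s n" for n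
    have bound: "0 \<le> autocorr (M n) (Z n) (root_cluster_size n) (s n) \<and>
        autocorr (M n) (Z n) (root_cluster_size n) (s n)
          \<le> ((real n + 2)\<^sup>2 * real n / R n) * (1 / real n + real (card (tree_edges n)) / real n / real (s n))"
      if n: "n \<ge> 1" for n
    proof
      define m where "m = real (card (tree_edges n))"
      have m: "1 \<le> m" using depth_le_card_tree_edges[of n] n by (simp add: m_def)
      note ac = autocorr_le_power_mean[OF Z[OF n] n, of "s n", folded x_def R_def]
      show "0 \<le> autocorr (M n) (Z n) (root_cluster_size n) (s n)" by (rule ac) auto
      have x: "0 \<le> x n" "x n \<le> m / (m + real (s n))"
        using one_minus_inverse_power_le[OF m, of "s n"] by (auto simp: x_def m_def)
      have "real (s n) / (m + real (s n)) = 1 - m / (m + real (s n))" using m by (simp add: field_simps)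
      also have "\<dots> \<le> 1 - x n" using x by simp
      finally have gap: "real (s n) / (m + real (s n)) \<le> 1 - x n" .
      have pos: "0 < real (s n) / (m + real (s n))" using m s[OF n] by (intro divide_pos_pos) auto
      have "autocorr (M n) (Z n) (root_cluster_size n) (s n) \<le> spectral_sum (1/2) n (\<lambda>k. x n ^ k) / R n"
        by (rule ac) auto
      also have "\<dots> \<le> ((real n + 2)\<^sup>2 / (1 - x n)) / R n"
        using R[OF n] x gap pos by (intro divide_right_mono spectral_sum_critical_power_le) auto
      also have "\<dots> \<le> ((real n + 2)\<^sup>2 / (real (s n) / (m + real (s n)))) / R n"
        using R[OF n] gap pos by (intro divide_right_mono divide_left_mono mult_pos_pos) auto
      also have "\<dots> = ((real n + 2)\<^sup>2 * real n / R n) * (1 / real n + m / real n / real (s n))"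
      proof -
        have cancel: "c / (a / (m + a)) / r = (c * k / r) * (1 / k + m / k / a)"
          if "k > 0" "a > 0" "r > 0" for c a r k :: real
          using that m by (simp add: field_simps)
        show ?thesis by (rule cancel) (use n s[OF n] R[OF n] in simp_all)
      qed
      finally show "autocorr (M n) (Z n) (root_cluster_size n) (s n)
          \<le> ((real n + 2)\<^sup>2 * real n / R n) * (1 / real n + real (card (tree_edges n)) / real n / real (s n))"
        by (simp add: m_def)
    qed
    have ratio: "(\<lambda>n. (real n + 2)\<^sup>2 * real n / R n) \<longlonglongrightarrow> 6"
    proof -
      have "(\<lambda>n. (real n + 2)\<^sup>2 * real n / real n ^ 3) \<longlonglongrightarrow> 1" by real_asymp
      from tendsto_divide[OF this critical_variance]
      have "(\<lambda>n. ((real n + 2)\<^sup>2 * real n / real n ^ 3) / (R n / real n ^ 3)) \<longlonglongrightarrow> 6" by (simp add: R_def)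
      moreover have "eventually (\<lambda>n. ((real n + 2)\<^sup>2 * real n / real n ^ 3) / (R n / real n ^ 3) = (real n + 2)\<^sup>2 * real n / R n) sequentially"
        using eventually_ge_at_top[of 1] by eventually_elim simp
      ultimately show ?thesis by (rule Lim_transform_eventually)
    qed
    have "(\<lambda>n. 1 / real n) \<longlonglongrightarrow> 0" by real_asymp
    from tendsto_mult[OF ratio tendsto_add[OF this smalloD_tendsto[OF \<open>?B\<close>]]]
    have upper: "(\<lambda>n. ((real n + 2)\<^sup>2 * real n / R n) * (1 / real n + real (card (tree_edges n)) / real n / real (s n))) \<longlonglongrightarrow> 0"
      by simp
    show "(\<lambda>n. autocorr (M n) (Z n) (root_cluster_size n) (s n)) \<longlonglongrightarrow> 0"
    proof (rule tendsto_sandwich[OF _ _ tendsto_const upper])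
      show "\<forall>\<^sub>F n in sequentially. 0 \<le> autocorr (M n) (Z n) (root_cluster_size n) (s n)"
        by (rule eventually_mono[OF eventually_ge_at_top[of 1]]) (use bound in blast)
      show "\<forall>\<^sub>F n in sequentially. autocorr (M n) (Z n) (root_cluster_size n) (s n)
          \<le> ((real n + 2)\<^sup>2 * real n / R n) * (1 / real n + real (card (tree_edges n)) / real n / real (s n))"
        by (rule eventually_mono[OF eventually_ge_at_top[of 1]]) (use bound in blast)
    qed
  }
qed

lemma inverse_card_tree_edges_le:
  "n \<ge> 1 \<Longrightarrow> 1 / (2 * real (card (tree_edges n))) \<le> 1 / (2 * real n)"
  using depth_le_card_tree_edges[of n] by (intro divide_left_mono) auto

lemma off_critical_autocorr_time:
  assumes p: "0 < p" "p < 1" "p \<noteq> 1/2"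
    and Z: "\<And>n. n \<ge> 1 \<Longrightarrow> dynamical_percolation p (tree_edges n) (M n) (Z n)"
  shows "(\<lambda>n. autocorr_time (M n) (Z n) (root_cluster_size n) / real (card (tree_edges n))) \<longlonglongrightarrow>
    (1 - meet_ratio p) / (meet_ratio p * (1 - p)) * ln ((1 - meet_ratio p * p) / (1 - meet_ratio p))"
proof (rule Lim_transform_eventually)
  have "(\<lambda>n. 1 / (2 * real (card (tree_edges n)))) \<longlonglongrightarrow> 0"
  proof (rule tendsto_sandwich[OF _ _ tendsto_const])
    show "(\<lambda>n. 1 / (2 * real n)) \<longlonglongrightarrow> 0" by real_asymp
    show "\<forall>\<^sub>F n in sequentially. 1 / (2 * real (card (tree_edges n))) \<le> 1 / (2 * real n)"
      using eventually_ge_at_top[of 1] by eventually_elim (rule inverse_card_tree_edges_le)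
  qed simp
  from tendsto_diff[OF off_critical_mean_reciprocal[OF p] this]
  show "(\<lambda>n. spectral_sum p n (\<lambda>k. 1 / real k) / spectral_sum p n (\<lambda>_. 1) - 1 / (2 * real (card (tree_edges n)))) \<longlonglongrightarrow>
    (1 - meet_ratio p) / (meet_ratio p * (1 - p)) * ln ((1 - meet_ratio p * p) / (1 - meet_ratio p))" by simp
  show "\<forall>\<^sub>F n in sequentially. spectral_sum p n (\<lambda>k. 1 / real k) / spectral_sum p n (\<lambda>_. 1) - 1 / (2 * real (card (tree_edges n)))
      = autocorr_time (M n) (Z n) (root_cluster_size n) / real (card (tree_edges n))"
    using eventually_ge_at_top[of 1] by eventually_elim (simp add: root_cluster_autocorr_time[OF Z _ p(1,2)])
qed

lemma critical_autocorr_time: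
  assumes Z: "\<And>n. n \<ge> 1 \<Longrightarrow> dynamical_percolation (1/2) (tree_edges n) (M n) (Z n)"
  shows "(\<lambda>n. autocorr_time (M n) (Z n) (root_cluster_size n) / real (card (tree_edges n)) / (ln (real n) / real n)) \<longlonglongrightarrow> 6"
proof (rule Lim_transform_eventually)
  have "(\<lambda>n. 1 / (2 * real (card (tree_edges n))) / (ln (real n) / real n)) \<longlonglongrightarrow> 0"
  proof (rule tendsto_sandwich[OF _ _ tendsto_const])
    show "(\<lambda>n. 1 / (2 * real n) / (ln (real n) / real n)) \<longlonglongrightarrow> 0" by real_asymp
    show "\<forall>\<^sub>F n in sequentially. 1 / (2 * real (card (tree_edges n))) / (ln (real n) / real n) \<le> 1 / (2 * real n) / (ln (real n) / real n)"
      using eventually_ge_at_top[of 1] by eventually_elim (intro divide_right_mono inverse_card_tree_edges_le; simp)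
    show "\<forall>\<^sub>F n in sequentially. 0 \<le> 1 / (2 * real (card (tree_edges n))) / (ln (real n) / real n)"
      using eventually_ge_at_top[of 1] by eventually_elim simp
  qed
  from tendsto_diff[OF critical_mean_reciprocal this]
  show "(\<lambda>n. (spectral_sum (1/2) n (\<lambda>k. 1 / real k) / spectral_sum (1/2) n (\<lambda>_. 1)) / (ln (real n) / real n)
      - 1 / (2 * real (card (tree_edges n))) / (ln (real n) / real n)) \<longlonglongrightarrow> 6" by simp
  show "\<forall>\<^sub>F n in sequentially. (spectral_sum (1/2) n (\<lambda>k. 1 / real k) / spectral_sum (1/2) n (\<lambda>_. 1)) / (ln (real n) / real n)
      - 1 / (2 * real (card (tree_edges n))) / (ln (real n) / real n)
      = autocorr_time (M n) (Z n) (root_cluster_size n) / real (card (tree_edges n)) / (ln (real n) / real n)"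
    using eventually_ge_at_top[of 1]
  proof eventually_elim
    case (elim n)
    have "0 < (1/2 :: real)" "(1/2 :: real) < 1" by simp_all
    from root_cluster_autocorr_time[OF Z[OF elim] elim this]
    show ?case by (simp only: diff_divide_distrib)
  qed
qed

lemma off_critical_constant:
  assumes "0 < p" "p < 1" "p \<noteq> 1/2"
  shows "(1 - meet_ratio p) / (meet_ratio p * (1 - p)) * ln ((1 - meet_ratio p * p) / (1 - meet_ratio p))
    = (if p < 1/2 then (1 - 2 * p) / (2 * p * (1 - p)) * ln ((1 - 2 * p\<^sup>2) / (1 - 2 * p))
       else (2 * p - 1) / (1 - p) * ln (p / (2 * p - 1)))"
    and "0 < (1 - meet_ratio p) / (meet_ratio p * (1 - p)) * ln ((1 - meet_ratio p * p) / (1 - meet_ratio p))"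
proof -
  have r: "0 < meet_ratio p" "meet_ratio p < 1" using meet_ratio_bounds[of p] assms by auto
  have "meet_ratio p * p < meet_ratio p" using r assms by simp
  then have "1 < (1 - meet_ratio p * p) / (1 - meet_ratio p)" using r by simp
  then show "0 < (1 - meet_ratio p) / (meet_ratio p * (1 - p)) * ln ((1 - meet_ratio p * p) / (1 - meet_ratio p))"
    using r assms by (intro mult_pos_pos divide_pos_pos ln_gt_zero) auto
  show "(1 - meet_ratio p) / (meet_ratio p * (1 - p)) * ln ((1 - meet_ratio p * p) / (1 - meet_ratio p))
    = (if p < 1/2 then (1 - 2 * p) / (2 * p * (1 - p)) * ln ((1 - 2 * p\<^sup>2) / (1 - 2 * p))
       else (2 * p - 1) / (1 - p) * ln (p / (2 * p - 1)))"
  proof (cases "p < 1/2")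
    case True
    then show ?thesis by (simp add: meet_ratio_def power2_eq_square mult.assoc)
  next
    case False
    then have p: "1 < 2 * p" using assms by auto
    have meet_ratio: "meet_ratio p = 1 / (2 * p)" using False by (simp add: meet_ratio_def)
    have a: "(1 - meet_ratio p) / (meet_ratio p * (1 - p)) = (2 * p - 1) / (1 - p)"
      using p assms by (simp add: meet_ratio field_simps)
    have b: "(1 - meet_ratio p * p) / (1 - meet_ratio p) = p / (2 * p - 1)"
      using p assms by (simp add: meet_ratio field_simps)
    show ?thesis unfolding a b using False by simp
  qed
qed

theorem proposition2p2:
  fixes p :: real
    and M :: "nat \<Rightarrow> 'w measure"
    and Z :: "nat \<Rightarrow> nat \<Rightarrow> 'w \<Rightarrow> bool list set \<Rightarrow> int"
  assumes p: "0 < p" "p < 1"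
    and Z: "\<And>n. n \<ge> 1 \<Longrightarrow> dynamical_percolation p (tree_edges n) (M n) (Z n)"
  shows
    "(p \<noteq> 1/2 \<longrightarrow>
       (\<forall>s :: nat \<Rightarrow> nat. (\<forall>n\<ge>1. s n > 0) \<longrightarrow>
          ((\<lambda>n. real (s n)) \<in> o(\<lambda>n. real (card (tree_edges n))) \<longrightarrow>
             (\<lambda>n. autocorr (M n) (Z n) (root_cluster_size n) (s n)) \<longlonglongrightarrow> 1) \<and>
          ((\<lambda>n. real (card (tree_edges n))) \<in> o(\<lambda>n. real (s n)) \<longrightarrow>
             (\<lambda>n. autocorr (M n) (Z n) (root_cluster_size n) (s n)) \<longlonglongrightarrow> 0))) \<and>
     (p = 1/2 \<longrightarrow>
       (\<forall>s :: nat \<Rightarrow> nat. (\<forall>n\<ge>1. s n > 0) \<longrightarrow>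
          ((\<lambda>n. real (s n)) \<in> o(\<lambda>n. real (card (tree_edges n)) / real n) \<longrightarrow>
             (\<lambda>n. autocorr (M n) (Z n) (root_cluster_size n) (s n)) \<longlonglongrightarrow> 1) \<and>
          ((\<lambda>n. real (card (tree_edges n)) / real n) \<in> o(\<lambda>n. real (s n)) \<longrightarrow>
             (\<lambda>n. autocorr (M n) (Z n) (root_cluster_size n) (s n)) \<longlonglongrightarrow> 0))) \<and>
     (\<lambda>n. autocorr_time (M n) (Z n) (root_cluster_size n) / real (card (tree_edges n)))
       \<sim>[at_top]
     (\<lambda>n. if p < 1/2 then (1 - 2 * p) / (2 * p * (1 - p)) * ln ((1 - 2 * p\<^sup>2) / (1 - 2 * p))
          else if p = 1/2 then 6 * (ln (real n) / real n)
          else (2 * p - 1) / (1 - p) * ln (p / (2 * p - 1)))"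
proof (cases "p = 1/2")
  case True
  have Z': "n \<ge> 1 \<Longrightarrow> dynamical_percolation (1/2) (tree_edges n) (M n) (Z n)" for n
    using Z True by simp
  have "(\<lambda>n. autocorr_time (M n) (Z n) (root_cluster_size n) / real (card (tree_edges n)) / (6 * (ln (real n) / real n))) \<longlonglongrightarrow> 1"
  proof -
    have "x / (6 * l) = x / l / 6" for x l :: real by simp
    then show ?thesis
      using tendsto_divide[OF critical_autocorr_time[OF Z'] tendsto_const[of 6]] by (simp only: div_self zero_neq_numeral not_False_eq_True)
  qed
  then have "(\<lambda>n. autocorr_time (M n) (Z n) (root_cluster_size n) / real (card (tree_edges n)))
       \<sim>[at_top] (\<lambda>n. 6 * (ln (real n) / real n))"
    by (rule asymp_equivI')
  with True critical_autocorr_limits[OF Z'] show ?thesis by simp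
next
  case False
  define c where "c = (1 - meet_ratio p) / (meet_ratio p * (1 - p)) * ln ((1 - meet_ratio p * p) / (1 - meet_ratio p))"
  have c: "c > 0" unfolding c_def by (rule off_critical_constant(2)[OF p False])
  have "(\<lambda>n. autocorr_time (M n) (Z n) (root_cluster_size n) / real (card (tree_edges n))) \<sim>[at_top] (\<lambda>_. c)"
    using off_critical_autocorr_time[OF p False Z] c
    by (intro tendsto_imp_asymp_equiv_const) (auto simp: c_def)
  moreover have "(\<lambda>n. if p < 1/2 then (1 - 2 * p) / (2 * p * (1 - p)) * ln ((1 - 2 * p\<^sup>2) / (1 - 2 * p))
          else if p = 1/2 then 6 * (ln (real n) / real n)
          else (2 * p - 1) / (1 - p) * ln (p / (2 * p - 1))) = (\<lambda>_. c)"
    unfolding c_def off_critical_constant(1)[OF p False] using False by (intro ext) simp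
  ultimately show ?thesis
    using False off_critical_autocorr_limits[OF p False Z] by simp
qed

end
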